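(* Let $N\ge1$ be an integer and let $s$ be a complex number with $\mathrm{Re}(s)>-2N-1$. Then, provided that $|\arg q|<\pi$, $$|R_N(s,q)|\le\frac{|E_{2N+1}(0)|}{(2N+1)!}\frac{|(s)_{2N+1}|}{|q|^{2N+1}}\sup_{r\ge0}\left|\Pi_{s+2N+1}((2r+1)\pi q)\right|,$$ where $r$ runs over the non-negative integers, and $$|R_N(s,q)|\le\frac{|E_{2N+1}(0)|}{(2N+1)!}\frac{|(s)_{2N+1}|}{|q|^{2N+1}}\frac{|s+2N+1|}{\mathrm{Re}(s)+2N+1}\,\sec^{\mathrm{Re}(s)+2N+2}\left(\frac{\arg q}{2}\right)\max\left(1,e^{-\mathrm{Im}(s)\arg q}\right).$$
   Context: For $|\arg q|<\pi$ ($q\neq 0$), $\zeta_E(s,q)$ denotes the alternating Hurwitz zeta function, defined for $\mathrm{Re}(s)>0$ by $\zeta_E(s,q)=\sum_{n=0}^\infty \frac{(-1)^n}{(n+q)^s}$ (principal branches) and extended to an entire function of $s\in\mathbb C$ by analytic continuation. $E_n(x)$ are the Euler polynomials, $\frac{2e^{xt}}{e^t+1}=\sum_{n\ge0}E_n(x)\frac{t^n}{n!}$ for $|t|<\pi$. $(s)_k=s(s+1)\cdots(s+k-1)$, $(s)_0=1$. Powers $q^{-s}$ are principal values. For an integer $N\ge1$ the remainder $R_N(s,q)$ is defined by the equality $$\zeta_E(s,q)=\frac12 q^{-s}-\frac12 q^{-s}\left(\sum_{k=0}^{N-1}\frac{E_{2k+1}(0)}{(2k+1)!}\frac{(s)_{2k+1}}{q^{2k+1}}+R_N(s,q)\right).$$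 For $|\arg w|<\pi$ the function $\Pi_p(w)$ is defined by $$\Pi_p(w)=\frac{w^p}{2}\left(e^{\frac{\pi}{2}\mathrm i p}e^{\mathrm i w}\,\Gamma(1-p,we^{\frac{\pi}{2}\mathrm i})+e^{-\frac{\pi}{2}\mathrm i p}e^{-\mathrm i w}\,\Gamma(1-p,we^{-\frac{\pi}{2}\mathrm i})\right),$$ where $\Gamma(a,z)$ is the (upper) incomplete gamma function, $\Gamma(a,z)=\int_z^\infty t^{a-1}e^{-t}\,dt$ for $|\arg z|<\pi$, continued analytically in $z$ on the Riemann surface of the logarithm (so $we^{\pm\frac{\pi}{2}\mathrm i}$ has argument $\arg w\pm\frac{\pi}{2}$). *)

theory Defs
  imports "HOL-Complex_Analysis.Complex_Analysis"
begin

text \<open>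
  The coefficients of the generating function are taken formally; that the series converges to
  the generating function on the disc of radius \<open>pi\<close> is lemma \<open>euler_poly_sums\<close> below.
\<close>

definition euler_poly :: "nat \<Rightarrow> complex \<Rightarrow> complex" where
  "euler_poly n x = fact n * fps_nth (2 * fps_exp x / (fps_exp 1 + 1)) n"

lemma exp_plus_1_nonzero:
  fixes t :: complex
  assumes "norm t < pi"
  shows "exp t + 1 \<noteq> 0"
proof
  assume "exp t + 1 = 0"
  hence "exp t = exp (\<i> * of_real pi)"
    by (simp add: add_eq_0_iff2 exp_pi_i')
  then obtain n :: int where n: "t = \<i> * of_real pi + (of_int (2 * n) * pi) * \<i>"
    using exp_eq[of t "\<i> * of_real pi"] by blast
  have "Im t = (2 * of_int n + 1) * pi"
    by (simp add: n algebra_simps)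
  hence "\<bar>Im t\<bar> = \<bar>real_of_int (2 * n + 1)\<bar> * pi"
    by (simp add: abs_mult)
  moreover have "1 \<le> \<bar>2 * n + 1\<bar>"
    by presburger
  hence "1 \<le> \<bar>real_of_int (2 * n + 1)\<bar>"
    by linarith
  ultimately have "pi \<le> \<bar>Im t\<bar>"
    by simp
  with abs_Im_le_cmod[of t] assms show False
    by linarith
qed

lemma euler_poly_sums:
  assumes "norm t < pi"
  shows "(\<lambda>n. euler_poly n x * t ^ n / fact n) sums (2 * exp (x * t) / (exp t + 1))"
proof -
  have "(\<lambda>t. 2 * exp (x * t) / (exp (1 * t) + 1)) has_fps_expansion
          (2 * fps_exp x / (fps_exp 1 + 1))"
    by (intro fps_expansion_intros) auto
  hence *: "(\<lambda>t. 2 * exp (x * t) / (exp t + 1)) has_fps_expansion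
          (2 * fps_exp x / (fps_exp 1 + 1))"
    by simp
  have "(\<lambda>n. fps_nth (2 * fps_exp x / (fps_exp 1 + 1)) n * t ^ n) sums
          (2 * exp (x * t) / (exp t + 1))"
    by (rule has_fps_expansion_imp_sums_complex[OF *, where r = "ereal pi"])
       (use assms exp_plus_1_nonzero in \<open>auto intro!: holomorphic_intros simp: eball_def\<close>)
  thus ?thesis
    by (simp add: euler_poly_def)
qed

text \<open>
  The unique entire function of \<open>s\<close> that agrees with the alternating series on the half-plane
  \<open>Re s > 0\<close>. For \<open>0 < Re s \<le> 1\<close> the series is only conditionally convergent, so it
  is summed in its natural order.
\<close>

definition alt_hurwitz_zeta :: "complex \<Rightarrow> complex \<Rightarrow> complex" where
  "alt_hurwitz_zeta s q =
     (THE f. f holomorphic_on UNIV \<and>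
        (\<forall>z. Re z > 0 \<longrightarrow> (\<lambda>n. (-1) ^ n / (of_nat n + q) powr z) sums f z)) s"

definition alt_hurwitz_remainder :: "nat \<Rightarrow> complex \<Rightarrow> complex \<Rightarrow> complex" where
  "alt_hurwitz_remainder N s q =
     (THE R. alt_hurwitz_zeta s q =
        1/2 * q powr (-s) -
        1/2 * q powr (-s) *
          ((\<Sum>k<N. euler_poly (2*k+1) 0 / fact (2*k+1) * (pochhammer s (2*k+1) / q ^ (2*k+1))) + R))"

lemma alt_hurwitz_remainder_eq:
  assumes "q \<noteq> 0"
  shows "alt_hurwitz_zeta s q =
           1/2 * q powr (-s) -
           1/2 * q powr (-s) *
             ((\<Sum>k<N. euler_poly (2*k+1) 0 / fact (2*k+1) * (pochhammer s (2*k+1) / q ^ (2*k+1))) +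
               alt_hurwitz_remainder N s q)"
proof -
  have unique: "\<exists>!R. a = 1/2 * b - 1/2 * b * (c + R)" if "b \<noteq> 0" for a b c :: complex
  proof
    show "a = 1/2 * b - 1/2 * b * (c + (1 - 2 * a / b - c))"
      using that by (simp add: field_simps)
  next
    fix R assume "a = 1/2 * b - 1/2 * b * (c + R)"
    thus "R = 1 - 2 * a / b - c"
      using that by (simp add: field_simps)
  qed
  show ?thesis
    unfolding alt_hurwitz_remainder_def
    by (rule theI', rule unique) (use assms in simp)
qed

text \<open>
  The upper incomplete gamma function in the cut plane, integrated along the horizontal ray from
  \<open>z\<close> to \<open>+\<infinity>\<close>; this ray avoids the branch cut of the integrand whenever
  \<open>\<bar>arg z\<bar> < pi\<close>.
\<close>

definition incomplete_Gamma :: "complex \<Rightarrow> complex \<Rightarrow> complex" where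
  "incomplete_Gamma a z =
     integral {0..} (\<lambda>x::real. (z + of_real x) powr (a - 1) * exp (-(z + of_real x)))"

text \<open>
  A point of the Riemann surface of the logarithm is represented by its logarithm \<open>l\<close>: its
  modulus is \<open>exp (Re l)\<close>, its argument \<open>Im l\<close>, and the principal sheet is
  \<open>\<bar>Im l\<bar> < pi\<close>. In this coordinate the analytic continuation of \<open>\<Gamma>(a,\<cdot>)\<close> is an
  entire function of \<open>l\<close>.
\<close>

definition incomplete_Gamma_log :: "complex \<Rightarrow> complex \<Rightarrow> complex" where
  "incomplete_Gamma_log a =
     (THE g. g holomorphic_on UNIV \<and>
        (\<forall>l. \<bar>Im l\<bar> < pi \<longrightarrow> g l = incomplete_Gamma a (exp l)))"

text \<open>
  Multiplying \<open>w\<close> by \<open>exp (\<plusminus>pi \<i>/2)\<close> on the Riemann surface adds \<open>\<plusminus>pi \<i>/2\<close> to its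
  logarithm.
\<close>

definition terminant :: "complex \<Rightarrow> complex \<Rightarrow> complex" where
  "terminant p w =
     w powr p / 2 *
       (exp (of_real pi / 2 * \<i> * p) * exp (\<i> * w) *
          incomplete_Gamma_log (1 - p) (Ln w + of_real pi / 2 * \<i>) +
        exp (-(of_real pi / 2) * \<i> * p) * exp (-(\<i> * w)) *
          incomplete_Gamma_log (1 - p) (Ln w - of_real pi / 2 * \<i>))"

end

theory Submission
  imports Defs
begin

text \<open>
  Put \<open>a r = (2 r + 1) pi\<close> and \<open>p = s + 2 N + 1\<close>. Boole's summation formula, the alternating
  analogue of Euler-Maclaurin, applied to \<open>x \<mapsto> (q + x) powr (- s)\<close> expresses the remainder
  as \<open>(s)\<^bsub>2N+2\<^esub>\<close> times the integral over \<open>{0..}\<close> of \<open>(q + x) powr (- p - 1)\<close> against a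
  periodic Euler polynomial, whose Fourier series is \<open>4 (1 - cos (a r x)) / a r ^ (2 N + 2)\<close> summed
  over \<open>r\<close>. Since the formula of every order agrees with the series for \<open>Re s > 0\<close>, it also
  provides the analytic continuation. On the other hand, for \<open>Re p > 0\<close> the function
  \<open>\<Pi>\<^sub>p (a q)\<close> equals \<open>p q\<^sup>p\<close> times the integral of \<open>(q + x) powr (- p - 1) * (1 - cos (a x))\<close>,
  so the remainder is a combination of the values \<open>\<Pi>\<^sub>p (a r q)\<close> with weights of constant sign
  whose sum is the Euler number. This gives the first bound. The second follows from the same
  integral: the weight \<open>1 - cos\<close> is nonnegative, and after bounding \<open>(q + x) powr (- p - 1)\<close>
  by a real power, dropping the cosine term only increases the integral, because the cosine
  transform of a convex decreasing function is nonnegative.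
\<close>

section \<open>Integrals over half-lines\<close>

text \<open>The gamma terms are therefore compared through derivatives in the coordinate
  \<open>l\<close>, and constants of integration are fixed on the positive real axis.

  The choice of 1 - cos instead of cos shapes everything else: the waves of order at least 1 vanish
  at 0 together with their derivatives, so raising the order leaves no boundary term at 0; all
  weights are nonnegative; and the mean value of the wave is the Euler number up to sign. That
  identification needs no table of Fourier coefficients: the summation formula is applied to exp(- t
  x), whose alternating sum is geometric.

  In the explicit bound, the secant comes from |q + x| >= (|q| + x) cos(arg q / 2), the quotient |p|
  / Re p from integrating (|q| + x) to the power - Re p - 1, and the maximum from the argument of q
  + x lying between 0 and arg q.\<close>

lemma has_integral_FTC_atLeast:
  fixes f F :: "real \<Rightarrow> 'a::euclidean_space"
  assumes f: "f absolutely_integrable_on {a..}"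
    and F: "\<And>x. x \<ge> a \<Longrightarrow> (F has_vector_derivative f x) (at x)"
    and L: "(F \<longlongrightarrow> L) at_top"
  shows "(f has_integral L - F a) {a..}"
proof (rule has_integral_dominated_convergence)
  \<comment> \<open>Truncations to \<open>{a..a + k}\<close> are dominated by the norm of
    \<open>f\<close>, so the compact fundamental theorem passes to the limit.\<close>
  define g where "g = (\<lambda>(k::nat) x. if x \<in> {a..a + real k} then f x else 0)"
  show "(g k has_integral F (a + real k) - F a) {a..}" for k
    unfolding g_def
  proof (subst has_integral_restrict)
    show "(f has_integral F (a + real k) - F a) {a..a + real k}"
      by (rule fundamental_theorem_of_calculus) (auto intro: has_vector_derivative_at_within[OF F])
  qed auto
  show "(\<lambda>x. norm (f x)) integrable_on {a..}"
    using f by (simp add: absolutely_integrable_on_def)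
  show "\<forall>x\<in>{a..}. norm (g k x) \<le> norm (f x)" for k
    by (auto simp: g_def)
  show "\<forall>x\<in>{a..}. (\<lambda>k. g k x) \<longlonglongrightarrow> f x"
  proof
    fix x assume "x \<in> {a..}"
    have "\<forall>\<^sub>F k in sequentially. g k x = f x"
      using eventually_ge_at_top[of "nat \<lceil>x - a\<rceil>"]
      by (rule eventually_mono) (use \<open>x \<in> {a..}\<close> in \<open>auto simp: g_def nat_le_iff ceiling_le_iff\<close>)
    then show "(\<lambda>k. g k x) \<longlonglongrightarrow> f x"
      by (rule tendsto_eventually)
  qed
  have "filterlim (\<lambda>k. a + real k) at_top sequentially"
    by real_asymp
  then show "(\<lambda>k. F (a + real k) - F a) \<longlonglongrightarrow> L - F a"
    by (intro tendsto_intros filterlim_compose[OF L])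
qed

lemma has_integral_shifted_powr:
  fixes \<rho> \<beta> :: real
  assumes "\<beta> < -1" "\<rho> > 0"
  shows "((\<lambda>x. (\<rho> + x) powr \<beta>) has_integral \<rho> powr (\<beta> + 1) / (- \<beta> - 1)) {0..}"
proof (rule has_integral_to_inf)
  define F where "F = (\<lambda>x. (\<rho> + x) powr (\<beta> + 1) / (\<beta> + 1))"
  have F: "((\<lambda>x. (\<rho> + x) powr \<beta>) has_integral (F y - F 0)) {0..y}" if "y \<ge> 0" for y
    unfolding F_def using assms
    by (intro fundamental_theorem_of_calculus that)
       (auto intro!: derivative_eq_intros simp flip: has_real_derivative_iff_has_vector_derivative)
  show "(\<lambda>x. (\<rho> + x) powr \<beta>) integrable_on {0..y}" for y
    using F[of y] by (cases "y \<ge> 0") (auto simp: integrable_on_def)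
  have "(F \<longlongrightarrow> 0) at_top"
    using assms unfolding F_def by real_asymp
  then have "((\<lambda>y. F y - F 0) \<longlongrightarrow> 0 - F 0) at_top"
    by (intro tendsto_intros)
  moreover have "\<forall>\<^sub>F y in at_top. F y - F 0 = integral {0..y} (\<lambda>x. (\<rho> + x) powr \<beta>)"
    using eventually_ge_at_top[of 0] by eventually_elim (metis F integral_unique)
  ultimately have "((\<lambda>y. integral {0..y} (\<lambda>x. (\<rho> + x) powr \<beta>)) \<longlongrightarrow> 0 - F 0) at_top"
    by (rule Lim_transform_eventually)
  moreover have "0 - F 0 = \<rho> powr (\<beta> + 1) / (- \<beta> - 1)"
    using assms by (simp add: F_def field_simps)
  ultimately show "((\<lambda>y. integral {0..y} (\<lambda>x. (\<rho> + x) powr \<beta>)) \<longlongrightarrow> \<rho> powr (\<beta> + 1) / (- \<beta> - 1)) at_top"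
    by simp
qed auto

section \<open>Geometry of the slit plane and bounds for complex powers\<close>

lemma add_nonneg_not_nonpos_Reals:
  fixes q :: complex and x :: real
  assumes "q \<notin> \<real>\<^sub>\<le>\<^sub>0" "x \<ge> 0"
  shows "q + of_real x \<notin> \<real>\<^sub>\<le>\<^sub>0"
  using assms by (auto simp: complex_nonpos_Reals_iff)

lemma abs_Arg_less_pi_iff:
  fixes q :: complex
  assumes "q \<noteq> 0"
  shows "\<bar>Arg q\<bar> < pi \<longleftrightarrow> q \<notin> \<real>\<^sub>\<le>\<^sub>0"
proof -
  have "\<bar>Arg q\<bar> < pi \<longleftrightarrow> Arg q \<noteq> pi"
    using Arg_bounded[of q] by linarith
  also have "\<dots> \<longleftrightarrow> q \<notin> \<real>\<^sub>\<le>\<^sub>0"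
    using assms unfolding Arg_eq_pi complex_nonpos_Reals_iff complex_eq_iff
    by (metis less_eq_real_def order_less_irrefl zero_complex.sel)
  finally show ?thesis .
qed

lemma cos_half_Arg_pos:
  assumes "q \<notin> \<real>\<^sub>\<le>\<^sub>0"
  shows "cos (Arg q / 2) > 0"
proof -
  have "\<bar>Arg q\<bar> < pi"
    using assms abs_Arg_less_pi_iff by (cases "q = 0") auto
  then show ?thesis
    by (intro cos_gt_zero_pi) auto
qed

text \<open>With c = cos(arg q / 2), the square of the right side exceeds the square of the left by
  exactly (1 - c^2)(|q| - x)^2. This is the source of the secant of the half angle in the final
  bound.\<close>

lemma norm_add_of_real_ge:
  fixes q :: complex
  assumes "q \<notin> \<real>\<^sub>\<le>\<^sub>0" "x \<ge> 0"
  shows "(norm q + x) * cos (Arg q / 2) \<le> norm (q + of_real x)"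
proof (rule power2_le_imp_le)
  define c where "c = cos (Arg q / 2)"
  have "Re q = norm q * cos (Arg q)"
    using Re_rcis[of "norm q" "Arg q"] by (simp only: rcis_cmod_Arg)
  also have "cos (Arg q) = 2 * c\<^sup>2 - 1"
    using cos_double_cos[of "Arg q / 2"] by (simp add: c_def)
  finally have Re: "Re q = norm q * (2 * c\<^sup>2 - 1)" .
  have "(norm (q + of_real x))\<^sup>2 = (norm q)\<^sup>2 + x\<^sup>2 + 2 * x * Re q"
    unfolding cmod_power2 by (simp add: power2_eq_square algebra_simps)
  also have "\<dots> = ((norm q + x) * c)\<^sup>2 + (1 - c\<^sup>2) * (norm q - x)\<^sup>2"
    unfolding Re by (simp add: power2_eq_square algebra_simps)
  also have "\<dots> \<ge> ((norm q + x) * c)\<^sup>2"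
    by (simp add: c_def abs_square_le_1)
  finally show "((norm q + x) * cos (Arg q / 2))\<^sup>2 \<le> (norm (q + of_real x))\<^sup>2"
    unfolding c_def .
qed auto

lemma norm_powr_le:
  fixes z b :: complex
  assumes "z \<noteq> 0"
  shows "norm (z powr b) \<le> norm z powr Re b * exp (pi * \<bar>Im b\<bar>)"
proof -
  have "- Im b * Arg z \<le> \<bar>Im b\<bar> * \<bar>Arg z\<bar>"
    by (metis abs_ge_self abs_minus_cancel abs_mult)
  also have "\<dots> \<le> \<bar>Im b\<bar> * pi"
    using Arg_bounded[of z] by (intro mult_left_mono) auto
  finally show ?thesis
    by (auto simp: norm_powr_complex mult.commute intro!: mult_left_mono)
qed

text \<open>The factor from the argument is bounded crudely through |Arg| <= pi. That suffices for
  integrability and limits at infinity; the sharp bound on the terminant treats the argument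
  separately.\<close>

lemma norm_shifted_powr_le:
  fixes q b :: complex
  assumes "q \<notin> \<real>\<^sub>\<le>\<^sub>0" "x \<ge> 0" "Re b \<le> 0"
  shows "norm ((q + of_real x) powr b) \<le>
           (norm q + x) powr Re b * (cos (Arg q / 2) powr Re b * exp (pi * \<bar>Im b\<bar>))"
proof -
  have q: "q \<noteq> 0"
    using assms by auto
  have "norm ((q + of_real x) powr b) \<le> norm (q + of_real x) powr Re b * exp (pi * \<bar>Im b\<bar>)"
    using add_nonneg_not_nonpos_Reals[OF assms(1,2)] by (intro norm_powr_le) (metis nonpos_Reals_zero_I)
  also have "\<dots> \<le> ((norm q + x) * cos (Arg q / 2)) powr Re b * exp (pi * \<bar>Im b\<bar>)"
    using norm_add_of_real_ge[OF assms(1,2)] cos_half_Arg_pos[OF assms(1)] assms q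
    by (intro mult_right_mono powr_mono2') (auto intro!: mult_pos_pos add_pos_nonneg)
  also have "\<dots> = (norm q + x) powr Re b * (cos (Arg q / 2) powr Re b * exp (pi * \<bar>Im b\<bar>))"
    using cos_half_Arg_pos[OF assms(1)] assms q by (simp add: powr_mult)
  finally show ?thesis .
qed

lemma has_vector_derivative_shifted_powr:
  fixes q b :: complex
  assumes "q \<notin> \<real>\<^sub>\<le>\<^sub>0" "x \<ge> 0"
  shows "((\<lambda>x::real. (q + of_real x) powr b) has_vector_derivative
           b * (q + of_real x) powr (b - 1)) (at x)"
proof -
  have "((\<lambda>z::complex. (q + z) powr b) has_field_derivative b * (q + of_real x) powr (b - 1)) (at (of_real x))"
    using add_nonneg_not_nonpos_Reals[OF assms]
    by (auto intro!: derivative_eq_intros)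
  then show ?thesis
    by (rule has_vector_derivative_real_field)
qed

lemma continuous_on_shifted_powr:
  fixes q b :: complex
  assumes "q \<notin> \<real>\<^sub>\<le>\<^sub>0"
  shows "continuous_on {0..} (\<lambda>x::real. (q + of_real x) powr b)"
  using has_vector_derivative_shifted_powr[OF assms]
  by (intro continuous_at_imp_continuous_on ballI has_vector_derivative_continuous) auto

lemma absolutely_integrable_shifted_powr:
  fixes q b :: complex and h :: "real \<Rightarrow> complex"
  assumes q: "q \<notin> \<real>\<^sub>\<le>\<^sub>0" and b: "Re b < -1"
    and h: "continuous_on {0..} h" and B: "\<And>x. x \<ge> 0 \<Longrightarrow> norm (h x) \<le> B"
  shows "(\<lambda>x. (q + of_real x) powr b * h x) absolutely_integrable_on {0..}"
proof (rule measurable_bounded_by_integrable_imp_absolutely_integrable)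
  define C where "C = cos (Arg q / 2) powr Re b * exp (pi * \<bar>Im b\<bar>)"
  show "(\<lambda>x. (q + of_real x) powr b * h x) \<in> borel_measurable (lebesgue_on {0..})"
    by (intro continuous_imp_measurable_on_sets_lebesgue continuous_on_mult
          continuous_on_shifted_powr q h) auto
  show "(\<lambda>x. (norm q + x) powr Re b * (C * B)) integrable_on {0..}"
    using has_integral_shifted_powr[OF b, of "norm q"] q
    by (intro integrable_on_mult_left) (metis has_integral_integrable nonpos_Reals_zero_I zero_less_norm_iff)
  show "norm ((q + of_real x) powr b * h x) \<le> (norm q + x) powr Re b * (C * B)"
    if "x \<in> {0..}" for x
  proof -
    have "norm ((q + of_real x) powr b) \<le> (norm q + x) powr Re b * C"
      using norm_shifted_powr_le[OF q, of x b] that b by (simp add: C_def)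
    then show ?thesis
      using B[of x] that unfolding norm_mult
      by (subst mult.assoc[symmetric], intro mult_mono) (auto simp: C_def)
  qed
qed auto

lemma tendsto_shifted_powr_0:
  fixes q b :: complex
  assumes q: "q \<notin> \<real>\<^sub>\<le>\<^sub>0" and b: "Re b < 0"
  shows "((\<lambda>x::real. (q + of_real x) powr b) \<longlongrightarrow> 0) at_top"
proof (rule Lim_null_comparison)
  define C where "C = cos (Arg q / 2) powr Re b * exp (pi * \<bar>Im b\<bar>)"
  show "\<forall>\<^sub>F x in at_top. norm ((q + of_real x) powr b) \<le> (norm q + x) powr Re b * C"
    using eventually_ge_at_top[of 0]
    by eventually_elim (use norm_shifted_powr_le[OF q, of _ b] b in \<open>simp add: C_def\<close>)
  have "((\<lambda>x. (norm q + x) powr Re b) \<longlongrightarrow> 0) at_top"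
    using b by real_asymp
  then show "((\<lambda>x. (norm q + x) powr Re b * C) \<longlongrightarrow> 0) at_top"
    by (rule tendsto_mult_left_zero)
qed

lemma has_integral_complex_shifted_powr:
  fixes q b :: complex
  assumes "q \<notin> \<real>\<^sub>\<le>\<^sub>0" "Re b < -1"
  shows "((\<lambda>x. (q + of_real x) powr b) has_integral - (q powr (b + 1) / (b + 1))) {0..}"
proof -
  have b1: "b + 1 \<noteq> 0"
    using assms by (auto simp: complex_eq_iff)
  have "((\<lambda>x. (q + of_real x) powr b) has_integral 0 / (b + 1) - (q + of_real 0) powr (b + 1) / (b + 1)) {0..}"
  proof (rule has_integral_FTC_atLeast)
    show "(\<lambda>x. (q + of_real x) powr b) absolutely_integrable_on {0..}"
      using absolutely_integrable_shifted_powr[OF assms, of "\<lambda>_. 1" 1] by simp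
    show "((\<lambda>x::real. (q + of_real x) powr (b + 1) / (b + 1)) \<longlongrightarrow> 0 / (b + 1)) at_top"
      using assms b1 by (intro tendsto_divide tendsto_shifted_powr_0 tendsto_const) auto
    show "((\<lambda>x::real. (q + of_real x) powr (b + 1) / (b + 1)) has_vector_derivative (q + of_real x) powr b) (at x)"
      if "x \<ge> 0" for x
      using has_vector_derivative_divide[OF has_vector_derivative_shifted_powr[OF assms(1) that, of "b + 1"], of "b + 1"] b1
      by simp
  qed
  then show ?thesis
    by simp
qed

section \<open>Tails of integrals of a power times an exponential\<close>

lemma nonpos_Reals_conv_image: "(\<real>\<^sub>\<le>\<^sub>0 :: complex set) = complex_of_real ` {..0}"
  by (auto simp: nonpos_Reals_def)

text \<open>The slit plane is starlike, so \<open>\<phi>\<close> has a primitive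
  \<open>\<Phi>\<close>, and the tail integral from \<open>w\<close> is the limit of
  \<open>\<Phi>\<close> along the ray minus \<open>\<Phi> w\<close>. Decay in horizontal strips
  makes that limit the same for all rays, so the tail integral differs from - \<open>\<Phi>\<close>
  by one global constant \<open>L\<close>.\<close>

lemma tail_integral_primitive:
  fixes \<phi> :: "complex \<Rightarrow> complex"
  defines "G \<equiv> \<lambda>w. integral {0..} (\<lambda>x::real. \<phi> (w + of_real x))"
  assumes hol: "\<phi> holomorphic_on - \<real>\<^sub>\<le>\<^sub>0"
    and int: "\<And>w. w \<notin> \<real>\<^sub>\<le>\<^sub>0 \<Longrightarrow> (\<lambda>x::real. \<phi> (w + of_real x)) absolutely_integrable_on {0..}"
    and decay: "\<And>B e. e > 0 \<Longrightarrow> \<exists>T. \<forall>z. Re z \<ge> T \<and> \<bar>Im z\<bar> \<le> B \<longrightarrow> norm (\<phi> z) \<le> e"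
  shows "w \<notin> \<real>\<^sub>\<le>\<^sub>0 \<Longrightarrow> (G has_field_derivative - \<phi> w) (at w)"
    and "((\<lambda>t::real. G (of_real t)) \<longlongrightarrow> 0) at_top"
proof -
  have op: "open (- \<real>\<^sub>\<le>\<^sub>0 :: complex set)"
    by (simp add: open_Compl)
  have "\<exists>\<Phi>. \<forall>z\<in>- \<real>\<^sub>\<le>\<^sub>0. (\<Phi> has_field_derivative \<phi> z) (at z)"
  proof (rule holomorphic_starlike_primitive[where k = "{}"])
    show "starlike (- \<real>\<^sub>\<le>\<^sub>0 :: complex set)"
      unfolding nonpos_Reals_conv_image by (rule starlike_slotted_complex_plane_left)
  qed (use hol op in \<open>auto intro: holomorphic_on_imp_continuous_on holomorphic_on_imp_differentiable_at\<close>)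
  then obtain \<Phi> where \<Phi>: "(\<Phi> has_field_derivative \<phi> z) (at z)" if "z \<notin> \<real>\<^sub>\<le>\<^sub>0" for z
    by blast
  have lim: "((\<lambda>t::real. \<Phi> (w + of_real t)) \<longlongrightarrow> G w + \<Phi> w) at_top" if w: "w \<notin> \<real>\<^sub>\<le>\<^sub>0" for w
  proof -
    have abs: "(\<lambda>x::real. \<phi> (w + of_real x)) absolutely_integrable_on {0..b}" for b
      by (rule set_integrable_subset[OF int[OF w]]) auto
    have "((\<lambda>b. set_lebesgue_integral lebesgue {0..b} (\<lambda>x::real. \<phi> (w + of_real x))) \<longlongrightarrow>
            set_lebesgue_integral lebesgue {0..} (\<lambda>x. \<phi> (w + of_real x))) at_top"
      by (rule tendsto_set_lebesgue_integral_at_top) (use int w in auto)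
    then have "((\<lambda>b. integral {0..b} (\<lambda>x::real. \<phi> (w + of_real x))) \<longlongrightarrow> G w) at_top"
      by (simp add: set_lebesgue_integral_eq_integral(2)[OF abs] G_def
           set_lebesgue_integral_eq_integral(2)[OF int[OF w]])
    moreover have "\<forall>\<^sub>F b in at_top. integral {0..b} (\<lambda>x::real. \<phi> (w + of_real x)) = \<Phi> (w + of_real b) - \<Phi> w"
      using eventually_ge_at_top[of 0]
    proof eventually_elim
      case (elim b)
      have "((\<lambda>x::real. \<phi> (w + of_real x)) has_integral \<Phi> (w + of_real b) - \<Phi> (w + of_real 0)) {0..b}"
      proof (rule fundamental_theorem_of_calculus[OF elim])
        fix x assume "x \<in> {0..b}"
        then have "((\<lambda>z. \<Phi> (w + z)) has_field_derivative \<phi> (w + of_real x) * (0 + 1)) (at (of_real x))"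
          using add_nonneg_not_nonpos_Reals[OF w] by (intro DERIV_chain2[OF \<Phi>]) (auto intro!: derivative_eq_intros)
        then show "((\<lambda>x::real. \<Phi> (w + of_real x)) has_vector_derivative \<phi> (w + of_real x)) (at x within {0..b})"
          using has_vector_derivative_at_within has_vector_derivative_real_field by fastforce
      qed
      then show ?case
        by (simp add: integral_unique)
    qed
    ultimately have "((\<lambda>b::real. \<Phi> (w + of_real b) - \<Phi> w) \<longlongrightarrow> G w) at_top"
      by (rule Lim_transform_eventually)
    from tendsto_add[OF this tendsto_const[of "\<Phi> w"]] show ?thesis
      by simp
  qed
  have one: "(1::complex) \<notin> \<real>\<^sub>\<le>\<^sub>0"
    by (simp add: complex_nonpos_Reals_iff)
  define L where "L = G 1 + \<Phi> 1"
  have G_eq: "G w = L - \<Phi> w" if w: "w \<notin> \<real>\<^sub>\<le>\<^sub>0" for w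
  proof -
    have "((\<lambda>t::real. \<Phi> (w + of_real t) - \<Phi> (1 + of_real t)) \<longlongrightarrow> 0) at_top"
    proof (rule tendstoI)
      fix e :: real assume e: "e > 0"
      define e' where "e' = e / (norm (w - 1) + 1)"
      have e': "e' > 0"
        using e by (auto simp: e'_def intro!: divide_pos_pos add_nonneg_pos)
      from decay[OF this, of "\<bar>Im w\<bar>"] obtain T
        where T: "\<And>z. Re z \<ge> T \<Longrightarrow> \<bar>Im z\<bar> \<le> \<bar>Im w\<bar> \<Longrightarrow> norm (\<phi> z) \<le> e'"
        by blast
      \<comment> \<open>Both moving points end up in this convex half-strip, where the derivative is
        at most \<open>e'\<close>, and their distance stays |w - 1|. The lower bound 1 on the real
        part keeps the strip off the cut; the summand 1 in the denominator of \<open>e'\<close>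
        covers w = 1.\<close>
      define S where "S = {z. Re z \<ge> max T 1} \<inter> {z. Im z \<ge> - \<bar>Im w\<bar>} \<inter> {z. Im z \<le> \<bar>Im w\<bar>}"
      have S: "z \<notin> \<real>\<^sub>\<le>\<^sub>0" "norm (\<phi> z) \<le> e'" if "z \<in> S" for z
        using that by (auto simp: S_def complex_nonpos_Reals_iff intro!: T)
      have "convex S"
        unfolding S_def by (intro convex_Int convex_halfspace_Re_ge convex_halfspace_Im_ge convex_halfspace_Im_le)
      have *: "norm (\<Phi> x - \<Phi> y) \<le> e' * norm (x - y)" if "x \<in> S" "y \<in> S" for x y
        by (rule field_differentiable_bound[OF \<open>convex S\<close> _ _ that])
           (use S in \<open>auto intro: has_field_derivative_at_within \<Phi>\<close>)
      show "\<forall>\<^sub>F t in at_top. dist (\<Phi> (w + complex_of_real t) - \<Phi> (1 + complex_of_real t)) 0 < e"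
        using eventually_ge_at_top[of "max T 1 + \<bar>Re w\<bar>"]
      proof eventually_elim
        case (elim t)
        have "norm (\<Phi> (w + of_real t) - \<Phi> (1 + of_real t)) \<le> e' * norm ((w + of_real t) - (1 + of_real t))"
          using elim by (intro *) (auto simp: S_def)
        also have "\<dots> < e' * (norm (w - 1) + 1)"
          using e' by (intro mult_strict_left_mono) auto
        also have "\<dots> = e"
          by (simp add: e'_def add_nonneg_eq_0_iff)
        finally show ?case
          by (simp add: dist_norm)
      qed
    qed
    moreover have "((\<lambda>t::real. \<Phi> (w + of_real t) - \<Phi> (1 + of_real t)) \<longlongrightarrow> (G w + \<Phi> w) - L) at_top"
      unfolding L_def by (intro tendsto_diff lim w one)
    ultimately have "(G w + \<Phi> w) - L = 0"
      using tendsto_unique trivial_limit_at_top_linorder by blast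
    then show ?thesis
      by (simp add: algebra_simps)
  qed
  show "(G has_field_derivative - \<phi> w) (at w)" if "w \<notin> \<real>\<^sub>\<le>\<^sub>0"
  proof (rule has_field_derivative_transform_within_open[OF _ op])
    show "((\<lambda>w. L - \<Phi> w) has_field_derivative - \<phi> w) (at w)"
      using that by (auto intro!: derivative_eq_intros \<Phi>)
  qed (use that G_eq in auto)
  have "filterlim (\<lambda>t::real. t - 1) at_top at_top"
    by real_asymp
  then have "((\<lambda>t. \<Phi> (1 + of_real (t - 1))) \<longlongrightarrow> L) at_top"
    unfolding L_def by (rule filterlim_compose[OF lim[OF one]])
  then have "((\<lambda>t::real. L - \<Phi> (of_real t)) \<longlongrightarrow> L - L) at_top"
    by (intro tendsto_diff tendsto_const) (simp add: algebra_simps)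
  moreover have "\<forall>\<^sub>F t in at_top. L - \<Phi> (complex_of_real t) = G (of_real t)"
    using eventually_gt_at_top[of 0]
    by eventually_elim (simp add: G_eq complex_nonpos_Reals_iff)
  ultimately show "((\<lambda>t::real. G (of_real t)) \<longlongrightarrow> 0) at_top"
    by (simp add: Lim_transform_eventually)
qed

text \<open>If Re c > 0, the exponential alone gives convergence. If c is imaginary, the exponential
  has constant modulus along the ray and the power has to decay faster than 1/x. The first case
  serves the incomplete gamma function (c = 1), the second the trigonometric integrals of the
  terminant.\<close>

lemma absolutely_integrable_powr_exp:
  assumes w: "w \<notin> \<real>\<^sub>\<le>\<^sub>0" and b: "Re b < 0" and c: "Re c > 0 \<or> Re c = 0 \<and> Re b < -1"
  shows "(\<lambda>x::real. (w + of_real x) powr b * exp (- c * (w + of_real x))) absolutely_integrable_on {0..}"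
proof (cases "Re c > 0")
  case False
  then show ?thesis
    using c by (intro absolutely_integrable_shifted_powr[where B = "exp (- Re (c * w))"] w)
       (auto intro!: continuous_intros simp: algebra_simps)
next
  case True
  have w0: "norm w > 0"
    using w by auto
  define C where "C = norm w powr Re b * (cos (Arg w / 2) powr Re b * exp (pi * \<bar>Im b\<bar>)) * exp (- Re (c * w))"
  show ?thesis
  proof (rule measurable_bounded_by_integrable_imp_absolutely_integrable)
    show "(\<lambda>x::real. (w + of_real x) powr b * exp (- c * (w + of_real x))) \<in> borel_measurable (lebesgue_on {0..})"
      by (intro continuous_imp_measurable_on_sets_lebesgue continuous_on_mult
            continuous_on_shifted_powr w) (auto intro!: continuous_intros)
    show "(\<lambda>x. C * exp (- Re c * x)) integrable_on {0..}"
      using has_integral_exp_minus_to_infinity[OF True, of 0]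
      by (intro integrable_on_mult_right) (auto simp: integrable_on_def)
    show "norm ((w + of_real x) powr b * exp (- c * (w + of_real x))) \<le> C * exp (- Re c * x)"
      if "x \<in> {0..}" for x
    proof -
      have "norm ((w + of_real x) powr b) \<le>
          (norm w + x) powr Re b * (cos (Arg w / 2) powr Re b * exp (pi * \<bar>Im b\<bar>))"
        using norm_shifted_powr_le[OF w, of x b] that b by simp
      also have "\<dots> \<le> norm w powr Re b * (cos (Arg w / 2) powr Re b * exp (pi * \<bar>Im b\<bar>))"
        using that b w0 by (intro mult_right_mono powr_mono2') auto
      finally have "norm ((w + of_real x) powr b) * (exp (- Re (c * w)) * exp (- Re c * x)) \<le>
          norm w powr Re b * (cos (Arg w / 2) powr Re b * exp (pi * \<bar>Im b\<bar>)) *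
            (exp (- Re (c * w)) * exp (- Re c * x))"
        by (intro mult_right_mono) auto
      then show ?thesis
        unfolding norm_mult norm_exp_eq_Re C_def
        by (simp add: algebra_simps exp_add exp_diff divide_simps exp_minus)
    qed
  qed auto
qed

lemma powr_exp_tail:
  fixes b c :: complex
  defines "G \<equiv> \<lambda>w. integral {0..} (\<lambda>x::real. (w + of_real x) powr b * exp (- c * (w + of_real x)))"
  assumes b: "Re b < 0" and c: "Re c > 0 \<or> Re c = 0 \<and> Re b < -1"
  shows "w \<notin> \<real>\<^sub>\<le>\<^sub>0 \<Longrightarrow> (G has_field_derivative - (w powr b * exp (- c * w))) (at w)"
    and "((\<lambda>t::real. G (of_real t)) \<longlongrightarrow> 0) at_top"
proof -
  have 1: "(\<lambda>w. w powr b * exp (- c * w)) holomorphic_on - \<real>\<^sub>\<le>\<^sub>0"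
    by (intro holomorphic_intros) auto
  have 2: "\<exists>T. \<forall>z. Re z \<ge> T \<and> \<bar>Im z\<bar> \<le> B \<longrightarrow> norm (z powr b * exp (- c * z)) \<le> e"
    if e: "e > 0" for B e
  proof -
    \<comment> \<open>The two factors bound what the argument of \<open>z\<close> contributes to the
      power and what the imaginary part of \<open>c\<close> contributes to the exponential on the
      strip.\<close>
    define K where "K = exp (pi * \<bar>Im b\<bar>) * exp (\<bar>Im c\<bar> * B)"
    have "((\<lambda>T. T powr Re b) \<longlongrightarrow> 0) at_top"
      using b by real_asymp
    then have "((\<lambda>T. T powr Re b * K) \<longlongrightarrow> 0) at_top"
      by (rule tendsto_mult_left_zero)
    then have "\<forall>\<^sub>F T in at_top. T powr Re b * K < e"
      using e by (auto simp: tendsto_iff dist_norm K_def)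
    then have "\<forall>\<^sub>F T in at_top. T powr Re b * K < e \<and> T > 0"
      using eventually_gt_at_top by eventually_elim auto
    then obtain T where T: "T powr Re b * K < e" "T > 0"
      using eventually_happens trivial_limit_at_top_linorder by blast
    have "norm (z powr b * exp (- c * z)) \<le> e" if z: "Re z \<ge> T" "\<bar>Im z\<bar> \<le> B" for z
    proof -
      have "z \<noteq> 0"
        using z T by auto
      have "norm (z powr b) \<le> norm z powr Re b * exp (pi * \<bar>Im b\<bar>)"
        by (rule norm_powr_le) fact
      also have "norm z powr Re b \<le> T powr Re b"
        using T b z complex_Re_le_cmod[of z] by (intro powr_mono2') auto
      finally have A: "norm (z powr b) \<le> T powr Re b * exp (pi * \<bar>Im b\<bar>)"
        by simp
      have "Im c * Im z \<le> \<bar>Im c\<bar> * \<bar>Im z\<bar>"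
        by (metis abs_ge_self abs_mult)
      also have "\<dots> \<le> \<bar>Im c\<bar> * B"
        using z by (intro mult_left_mono) auto
      finally have "Re (- c * z) \<le> \<bar>Im c\<bar> * B"
        using c z T mult_nonneg_nonneg[of "Re c" "Re z"] by (auto simp del: mult_nonneg_nonneg)
      then have "norm (exp (- c * z)) \<le> exp (\<bar>Im c\<bar> * B)"
        by (simp only: norm_exp_eq_Re exp_le_cancel_iff)
      with A have "norm (z powr b * exp (- c * z)) \<le> (T powr Re b * exp (pi * \<bar>Im b\<bar>)) * exp (\<bar>Im c\<bar> * B)"
        unfolding norm_mult by (intro mult_mono) auto
      also have "\<dots> \<le> e"
        using T by (simp add: K_def mult_ac)
      finally show ?thesis .
    qed
    then show ?thesis
      by blast
  qed
  note * = tail_integral_primitive[OF 1 absolutely_integrable_powr_exp[OF _ b c] 2]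
  show "w \<notin> \<real>\<^sub>\<le>\<^sub>0 \<Longrightarrow> (G has_field_derivative - (w powr b * exp (- c * w))) (at w)"
    using *(1)[of w] by (simp add: G_def)
  show "((\<lambda>t::real. G (of_real t)) \<longlongrightarrow> 0) at_top"
    using *(2) by (simp add: G_def)
qed

section \<open>The incomplete gamma function on the Riemann surface of the logarithm\<close>

lemma incomplete_Gamma_has_field_derivative:
  assumes "Re a < 1" "z \<notin> \<real>\<^sub>\<le>\<^sub>0"
  shows "(incomplete_Gamma a has_field_derivative - (z powr (a - 1) * exp (- z))) (at z)"
proof -
  have "incomplete_Gamma a = (\<lambda>w. integral {0..} (\<lambda>x::real. (w + of_real x) powr (a - 1) * exp (- 1 * (w + of_real x))))"
    by (simp add: fun_eq_iff incomplete_Gamma_def)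
  then show ?thesis
    using powr_exp_tail(1)[of "a - 1" 1 z] assms by simp
qed

text \<open>In the coordinate l = log z the form - z^(a-1) e^(-z) dz becomes - exp(a l - exp l) dl,
  which is entire. Its primitive, corrected by a constant on the strip |Im l| < pi, is the required
  continuation, and the identity theorem makes it the only one, so the definite description is
  meaningful. The hypothesis on \<open>a\<close> becomes Re p > 0 for a = 1 - p.\<close>

lemma incomplete_Gamma_log_works:
  assumes a: "Re a < 1"
  shows "(incomplete_Gamma_log a has_field_derivative - exp (a * l - exp l)) (at l)"
    and "\<bar>Im l\<bar> < pi \<Longrightarrow> incomplete_Gamma_log a l = incomplete_Gamma a (exp l)"
proof -
  define S where "S = {l. \<bar>Im l\<bar> < pi}"
  have S_eq: "S = {l. Im l < pi} \<inter> {l. Im l > - pi}"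
    by (auto simp: S_def)
  have S: "open S" "connected S" "0 \<in> S"
    unfolding S_eq using pi_gt_zero
    by (auto intro!: open_Int convex_connected convex_Int convex_halfspace_Im_lt convex_halfspace_Im_gt
        open_halfspace_Im_lt open_halfspace_Im_gt)
  have exp_S: "exp l \<notin> \<real>\<^sub>\<le>\<^sub>0" if "l \<in> S" for l
  proof -
    have "Ln (exp l) = l"
      using that by (intro Ln_exp) (auto simp: S_def)
    then show ?thesis
      using that by (subst abs_Arg_less_pi_iff[symmetric]) (auto simp: S_def Arg_eq_Im_Ln)
  qed
  have "(\<lambda>l. - exp (a * l - exp l)) holomorphic_on UNIV"
    by (intro holomorphic_intros)
  then obtain P where P: "(P has_field_derivative - exp (a * l - exp l)) (at l)" for l
    using holomorphic_convex_primitive'[of UNIV "\<lambda>l. - exp (a * l - exp l)"] by auto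
  have "\<exists>c. \<forall>l\<in>S. incomplete_Gamma a (exp l) - P l = c"
  proof -
    have "((\<lambda>l. incomplete_Gamma a (exp l) - P l) has_field_derivative 0) (at l)" if l: "l \<in> S" for l
    proof -
      have Ln: "Ln (exp l) = l"
        using l by (intro Ln_exp) (auto simp: S_def)
      have "((\<lambda>l. incomplete_Gamma a (exp l) - P l) has_field_derivative
           - (exp l powr (a - 1) * exp (- exp l)) * exp l - (- exp (a * l - exp l))) (at l)"
        by (intro derivative_intros DERIV_chain2[OF incomplete_Gamma_has_field_derivative] exp_S l a P DERIV_exp)
      then show ?thesis
        by (simp add: powr_def Ln algebra_simps flip: exp_add)
    qed
    then show ?thesis
      using has_field_derivative_0_imp_constant_on[of S] S by (auto simp: constant_on_def)
  qed
  then obtain c where c: "incomplete_Gamma a (exp l) - P l = c" if "l \<in> S" for l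
    by blast
  define g where "g = (\<lambda>l. P l + c)"
  have g_deriv: "(g has_field_derivative - exp (a * l - exp l)) (at l)" for l
    unfolding g_def by (auto intro!: derivative_eq_intros P)
  have g_eq: "g l = incomplete_Gamma a (exp l)" if "\<bar>Im l\<bar> < pi" for l
    using c[of l] that by (auto simp: g_def S_def algebra_simps)
  have "incomplete_Gamma_log a = g"
    unfolding incomplete_Gamma_log_def
  proof (rule the_equality)
    show "g holomorphic_on UNIV \<and> (\<forall>l. \<bar>Im l\<bar> < pi \<longrightarrow> g l = incomplete_Gamma a (exp l))"
      using g_deriv g_eq by (auto simp: holomorphic_on_open)
  next
    fix h assume h: "h holomorphic_on UNIV \<and> (\<forall>l. \<bar>Im l\<bar> < pi \<longrightarrow> h l = incomplete_Gamma a (exp l))"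
    have "h l = g l" for l
    proof (rule analytic_continuation_open[of S UNIV h g])
      show "g holomorphic_on UNIV"
        using g_deriv by (auto simp: holomorphic_on_open)
    qed (use h g_eq S in \<open>auto simp: S_def intro: exI[of _ 0]\<close>)
    then show "h = g"
      by blast
  qed
  then show "(incomplete_Gamma_log a has_field_derivative - exp (a * l - exp l)) (at l)"
    and "\<bar>Im l\<bar> < pi \<Longrightarrow> incomplete_Gamma_log a l = incomplete_Gamma a (exp l)"
    using g_deriv g_eq by auto
qed

section \<open>The terminant function\<close>

text \<open>For imaginary z one has |z + x| >= |z| and |exp(- z - x)| = exp(- x), so the integral is
  at most a constant times |z| to the power - Re p. This limit fixes the constant of integration
  when the rotated gamma function is compared with an integral over the ray from
  \<open>q\<close>.\<close>

lemma tendsto_incomplete_Gamma_imaginary: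
  assumes p: "Re p > 0" and \<kappa>: "Re \<kappa> = 0" "\<kappa> \<noteq> 0"
  shows "((\<lambda>t::real. incomplete_Gamma (1 - p) (\<kappa> * exp (of_real t))) \<longlongrightarrow> 0) at_top"
proof (rule Lim_null_comparison)
  define C where "C = exp (pi * \<bar>Im p\<bar>) * norm \<kappa> powr (- Re p)"
  show "\<forall>\<^sub>F t in at_top. norm (incomplete_Gamma (1 - p) (\<kappa> * exp (of_real t))) \<le> C * exp (- Re p * t)"
  proof (rule always_eventually, rule allI)
    fix t :: real
    define z where "z = \<kappa> * exp (of_real t)"
    have Re_z: "Re z = 0"
      using \<kappa> by (simp add: z_def Re_exp Im_exp)
    have z0: "z \<noteq> 0"
      using \<kappa> by (simp add: z_def)
    with Re_z have z: "z \<notin> \<real>\<^sub>\<le>\<^sub>0"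
      by (auto simp: complex_nonpos_Reals_iff complex_eq_iff)
    have norm_z: "norm z = norm \<kappa> * exp t"
      by (simp add: z_def norm_mult)
    have "norm (incomplete_Gamma (1 - p) z) \<le> integral {0..} (\<lambda>x. C * exp (- Re p * t) * exp (- 1 * x))"
      unfolding incomplete_Gamma_def
    proof (rule integral_norm_bound_integral)
      show "(\<lambda>x::real. (z + of_real x) powr (1 - p - 1) * exp (- (z + of_real x))) integrable_on {0..}"
        using absolutely_integrable_powr_exp[OF z, of "- p" 1] p
        by (auto intro: set_lebesgue_integral_eq_integral(1))
      show "(\<lambda>x::real. C * exp (- Re p * t) * exp (- 1 * x)) integrable_on {0..}"
        using has_integral_exp_minus_to_infinity[of 1 0]
        by (intro integrable_on_mult_right) (auto simp: integrable_on_def)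
      fix x :: real assume x: "x \<in> {0..}"
      have zx: "norm z \<le> norm (z + of_real x)"
        using Re_z by (simp add: cmod_def)
      have "norm ((z + of_real x) powr (- p)) \<le> norm (z + of_real x) powr (Re (- p)) * exp (pi * \<bar>Im (- p)\<bar>)"
        using zx z0 by (intro norm_powr_le) auto
      also have "norm (z + of_real x) powr (Re (- p)) \<le> norm z powr (Re (- p))"
        using zx z0 p by (intro powr_mono2') auto
      also have "norm z powr (Re (- p)) * exp (pi * \<bar>Im (- p)\<bar>) = C * exp (- Re p * t)"
        using \<kappa> by (simp add: norm_z C_def powr_mult exp_powr_real mult_ac)
      finally have "norm ((z + of_real x) powr (- p)) \<le> C * exp (- Re p * t)"
        by simp
      then show "norm ((z + of_real x) powr (1 - p - 1) * exp (- (z + of_real x)))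
          \<le> C * exp (- Re p * t) * exp (- 1 * x)"
        using Re_z by (simp add: norm_mult)
    qed
    also have "\<dots> = C * exp (- Re p * t)"
      using has_integral_exp_minus_to_infinity[of 1 0] by (simp add: integral_unique)
    finally show "norm (incomplete_Gamma (1 - p) (\<kappa> * exp (of_real t))) \<le> C * exp (- Re p * t)"
      by (simp add: z_def)
  qed
  show "((\<lambda>t. C * exp (- Re p * t)) \<longlongrightarrow> 0) at_top"
    by (rule tendsto_mult_right_zero) (use p in real_asymp)
qed

text \<open>
  As functions of \<open>l = Ln q\<close>, both sides have the same derivative, and both
  tend to \<open>0\<close> along the positive real axis once the exponential prefactors are removed.
\<close>

lemma incomplete_Gamma_log_shift:
  assumes p: "Re p > 0" and c: "Re (exp c) = 0" "\<bar>Im c\<bar> < pi" and q: "q \<notin> \<real>\<^sub>\<le>\<^sub>0"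
  shows "exp (p * (Ln q + c)) * exp (exp c * q) * incomplete_Gamma_log (1 - p) (Ln q + c) =
           1 - p * q powr p * integral {0..} (\<lambda>x::real. (q + of_real x) powr (- p - 1) * exp (- exp c * of_real x))"
proof -
  define \<kappa> where "\<kappa> = exp c"
  have \<kappa>: "Re \<kappa> = 0" "\<kappa> \<noteq> 0"
    using c by (auto simp: \<kappa>_def)
  define G where "G = (\<lambda>w. integral {0..} (\<lambda>x::real. (w + of_real x) powr (- p - 1) * exp (- \<kappa> * (w + of_real x))))"
  have G_deriv: "(G has_field_derivative - (w powr (- p - 1) * exp (- \<kappa> * w))) (at w)" if "w \<notin> \<real>\<^sub>\<le>\<^sub>0" for w
    unfolding G_def using powr_exp_tail(1)[of "- p - 1" \<kappa> w] p \<kappa> that by simp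
  have G_lim: "((\<lambda>t::real. G (of_real t)) \<longlongrightarrow> 0) at_top"
    unfolding G_def using powr_exp_tail(2)[of "- p - 1" \<kappa>] p \<kappa> by simp
  define g where "g = incomplete_Gamma_log (1 - p)"
  have g_deriv: "(g has_field_derivative - exp ((1 - p) * l - exp l)) (at l)" for l
    unfolding g_def using p by (intro incomplete_Gamma_log_works) auto
  define S where "S = {l. \<bar>Im l\<bar> < pi}"
  have S_eq: "S = {l. Im l < pi} \<inter> {l. Im l > - pi}"
    by (auto simp: S_def)
  have S: "open S" "connected S"
    unfolding S_eq
    by (auto intro!: open_Int convex_connected convex_Int convex_halfspace_Im_lt convex_halfspace_Im_gt
        open_halfspace_Im_lt open_halfspace_Im_gt)
  \<comment> \<open>The difference of the two sides of the claim at q = exp l, divided by the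
    prefactors exp(p (l + c)) and exp(\<open>\<kappa>\<close> exp l). The derivative of the
    \<open>G\<close> term cancels the part of the derivative of the elementary term that carries the
    factor p; the rest cancels against \<open>g\<close>.\<close>
  define D where "D = (\<lambda>l. g (l + c) - exp (- p * c) * (exp (- p * l - \<kappa> * exp l) - p * G (exp l)))"
  have "(D has_field_derivative 0) (at l)" if l: "l \<in> S" for l
  proof -
    have Ln: "Ln (exp l) = l"
      using l by (intro Ln_exp) (auto simp: S_def)
    have el: "exp l \<notin> \<real>\<^sub>\<le>\<^sub>0"
      using l Ln by (subst abs_Arg_less_pi_iff[symmetric]) (auto simp: S_def Arg_eq_Im_Ln)
    have 1: "((\<lambda>l. g (l + c)) has_field_derivative - exp ((1 - p) * (l + c) - exp (l + c)) * 1) (at l)"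
      by (rule DERIV_chain2[OF g_deriv]) (auto intro!: derivative_eq_intros)
    have 2: "((\<lambda>l. G (exp l)) has_field_derivative - (exp l powr (- p - 1) * exp (- \<kappa> * exp l)) * exp l) (at l)"
      by (rule DERIV_chain2[where f = G and g = exp, OF G_deriv[OF el]]) (auto intro!: derivative_eq_intros)
    have 3: "((\<lambda>l. exp (- p * l - \<kappa> * exp l)) has_field_derivative
        exp (- p * l - \<kappa> * exp l) * (- p - \<kappa> * exp l)) (at l)"
      by (auto intro!: derivative_eq_intros)
    define E where "E = exp (- p * c) * exp (- p * l - \<kappa> * exp l)"
    have E1: "exp ((1 - p) * (l + c) - exp (l + c)) = E * (\<kappa> * exp l)"
      by (simp add: E_def \<kappa>_def algebra_simps flip: exp_add)
    have "exp l powr (- p - 1) * exp (- \<kappa> * exp l) * exp l = exp (- p * l - \<kappa> * exp l)"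
      by (simp add: powr_def Ln algebra_simps flip: exp_add)
    then have E2: "exp (- p * c) * (exp l powr (- p - 1) * exp (- \<kappa> * exp l) * exp l) = E"
      by (simp add: E_def)
    have "(D has_field_derivative - exp ((1 - p) * (l + c) - exp (l + c)) * 1 -
        exp (- p * c) * (exp (- p * l - \<kappa> * exp l) * (- p - \<kappa> * exp l) -
          p * (- (exp l powr (- p - 1) * exp (- \<kappa> * exp l)) * exp l))) (at l)"
      unfolding D_def by (intro DERIV_diff DERIV_cmult 1 2 3)
    also have "- exp ((1 - p) * (l + c) - exp (l + c)) * 1 -
        exp (- p * c) * (exp (- p * l - \<kappa> * exp l) * (- p - \<kappa> * exp l) -
          p * (- (exp l powr (- p - 1) * exp (- \<kappa> * exp l)) * exp l)) =
        - (E * (\<kappa> * exp l)) - (E * (- p - \<kappa> * exp l) +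
          p * (exp (- p * c) * (exp l powr (- p - 1) * exp (- \<kappa> * exp l) * exp l)))"
      unfolding E1 by (simp add: E_def algebra_simps)
    also have "\<dots> = 0"
      unfolding E2 by (simp add: algebra_simps)
    finally show ?thesis .
  qed
  then obtain K where K: "D l = K" if "l \<in> S" for l
    using has_field_derivative_0_imp_constant_on[of S D] S by (auto simp: constant_on_def)
  have "((\<lambda>t::real. D (of_real t)) \<longlongrightarrow> 0 - exp (- p * c) * (0 - p * 0)) at_top"
    unfolding D_def
  proof (intro tendsto_diff tendsto_mult tendsto_const)
    \<comment> \<open>For real \<open>t\<close> the point t + c stays in the principal strip because
      |Im c| < pi, so here the continuation is the ordinary integral.\<close>
    have "g (of_real t + c) = incomplete_Gamma (1 - p) (\<kappa> * exp (of_real t))" for t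
      unfolding g_def using p c by (subst incomplete_Gamma_log_works) (auto simp: \<kappa>_def exp_add mult.commute)
    then show "((\<lambda>t::real. g (of_real t + c)) \<longlongrightarrow> 0) at_top"
      using tendsto_incomplete_Gamma_imaginary[OF p \<kappa>] by simp
    have "norm (exp (- p * of_real t - \<kappa> * exp (of_real t))) = exp (- Re p * t)" for t
      using \<kappa> by (simp add: Im_exp)
    moreover have "((\<lambda>t. exp (- Re p * t)) \<longlongrightarrow> 0) at_top"
      using p by real_asymp
    ultimately show "((\<lambda>t::real. exp (- p * of_real t - \<kappa> * exp (of_real t))) \<longlongrightarrow> 0) at_top"
      by (subst tendsto_norm_zero_iff[symmetric]) simp
    show "((\<lambda>t::real. G (exp (of_real t))) \<longlongrightarrow> 0) at_top"
      using filterlim_compose[OF G_lim exp_at_top] by (simp add: exp_of_real)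
  qed
  moreover have "((\<lambda>t::real. D (of_real t)) \<longlongrightarrow> K) at_top"
    using K by (simp add: S_def)
  ultimately have "K = 0"
    using tendsto_unique trivial_limit_at_top_linorder by fastforce
  have q0: "q \<noteq> 0"
    using q by auto
  have "\<bar>Im (Ln q)\<bar> < pi"
    using q q0 abs_Arg_less_pi_iff[of q] by (simp add: Arg_eq_Im_Ln)
  then have "D (Ln q) = 0"
    using K[of "Ln q"] \<open>K = 0\<close> by (simp add: S_def)
  then have g_eq: "g (Ln q + c) = exp (- p * c) * (exp (- p * Ln q - \<kappa> * q) - p * G q)"
    using q0 by (simp add: D_def)
  have "G q = integral {0..} (\<lambda>x::real. exp (- \<kappa> * q) * ((q + of_real x) powr (- p - 1) * exp (- \<kappa> * of_real x)))"
    unfolding G_def by (rule arg_cong[where f = "integral {0..}"]) (simp add: fun_eq_iff algebra_simps exp_add exp_diff exp_minus divide_inverse)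
  then have G_eq: "G q = exp (- \<kappa> * q) * integral {0..} (\<lambda>x::real. (q + of_real x) powr (- p - 1) * exp (- \<kappa> * of_real x))"
    by simp
  have "exp (p * (Ln q + c)) * exp (\<kappa> * q) * g (Ln q + c) =
      1 - p * q powr p * integral {0..} (\<lambda>x::real. (q + of_real x) powr (- p - 1) * exp (- \<kappa> * of_real x))"
    unfolding g_eq G_eq using q0
    by (simp add: powr_def algebra_simps exp_add exp_diff exp_minus) (simp add: field_simps)
  then show ?thesis
    by (simp add: g_def \<kappa>_def)
qed

text \<open>The two gamma terms of the terminant are the cases exp c = i a and exp c = - i a of the
  shift formula, so the terminant is 1 minus p q^p times an integral against the average of exp(- i
  a x) and exp(i a x), which is cos(a x).\<close>

lemma terminant_eq_integral:
  fixes p q :: complex and a :: real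
  assumes p: "Re p > 0" and q: "q \<notin> \<real>\<^sub>\<le>\<^sub>0" and a: "a > 0"
  shows "terminant p (of_real a * q) =
           p * q powr p * integral {0..} (\<lambda>x::real. (q + of_real x) powr (- p - 1) * of_real (1 - cos (a * x)))"
proof -
  define I where "I = (\<lambda>\<kappa>. integral {0..} (\<lambda>x::real. (q + of_real x) powr (- p - 1) * exp (- \<kappa> * of_real x)))"
  have q0: "q \<noteq> 0"
    using q by auto
  have Ln: "Ln (of_real a * q) = Ln q + of_real (ln a)"
    using Ln_times_of_real[OF a q0] a by (simp add: add.commute Ln_of_real)
  have P: "(of_real a * q) powr p = exp (p * (Ln q + of_real (ln a)))"
    using q0 a by (simp add: powr_def Ln)
  \<comment> \<open>Since Ln(a q) = Ln q + ln a, the positive factor \<open>a\<close> and the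
    quarter turn are absorbed into one shift of the logarithm.\<close>
  define c where "c = of_real (ln a) + of_real pi / 2 * \<i>"
  define d where "d = of_real (ln a) - of_real pi / 2 * \<i>"
  have c: "exp c = of_real a * \<i>" and d: "exp d = - of_real a * \<i>"
    using a by (auto simp: c_def d_def complex_eq_iff Re_exp Im_exp)
  have 1: "exp (p * (Ln q + c)) * exp (exp c * q) * incomplete_Gamma_log (1 - p) (Ln q + c) = 1 - p * q powr p * I (exp c)"
    unfolding I_def by (rule incomplete_Gamma_log_shift) (use p q c in \<open>auto simp: c_def\<close>)
  have 2: "exp (p * (Ln q + d)) * exp (exp d * q) * incomplete_Gamma_log (1 - p) (Ln q + d) = 1 - p * q powr p * I (exp d)"
    unfolding I_def by (rule incomplete_Gamma_log_shift) (use p q d in \<open>auto simp: d_def\<close>)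
  have "terminant p (of_real a * q) =
     1/2 * ((exp (p * (Ln q + of_real (ln a))) * exp (of_real pi / 2 * \<i> * p)) * exp (\<i> * (of_real a * q)) *
          incomplete_Gamma_log (1 - p) (Ln q + of_real (ln a) + of_real pi / 2 * \<i>) +
        (exp (p * (Ln q + of_real (ln a))) * exp (- (of_real pi / 2) * \<i> * p)) * exp (- (\<i> * (of_real a * q))) *
          incomplete_Gamma_log (1 - p) (Ln q + of_real (ln a) - of_real pi / 2 * \<i>))"
    unfolding terminant_def P Ln by (simp add: algebra_simps add_divide_distrib)
  also have "exp (p * (Ln q + of_real (ln a))) * exp (of_real pi / 2 * \<i> * p) = exp (p * (Ln q + c))"
    unfolding exp_add[symmetric] by (simp add: c_def algebra_simps)
  also have "exp (p * (Ln q + of_real (ln a))) * exp (- (of_real pi / 2) * \<i> * p) = exp (p * (Ln q + d))"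
    unfolding exp_add[symmetric] by (simp add: d_def algebra_simps)
  also have "exp (\<i> * (of_real a * q)) = exp (exp c * q)"
    by (simp add: c mult_ac)
  also have "exp (- (\<i> * (of_real a * q))) = exp (exp d * q)"
    by (simp add: d mult_ac)
  also have "Ln q + of_real (ln a) + of_real pi / 2 * \<i> = Ln q + c"
    by (simp add: c_def)
  also have "Ln q + of_real (ln a) - of_real pi / 2 * \<i> = Ln q + d"
    by (simp add: d_def)
  finally have T: "terminant p (of_real a * q) = 1 - p * q powr p * ((I (exp c) + I (exp d)) / 2)"
    unfolding 1 2 by (simp add: field_simps)
  \<comment> \<open>The constant 1 is p q^p times this integral; it supplies the 1 in the weight 1 -
    cos.\<close>
  have J: "((\<lambda>x::real. (q + of_real x) powr (- p - 1)) has_integral (q powr (- p) / p)) {0..}"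
    using has_integral_complex_shifted_powr[OF q, of "- p - 1"] p by simp
  have I: "((\<lambda>x::real. (q + of_real x) powr (- p - 1) * exp (- \<kappa> * of_real x)) has_integral I \<kappa>) {0..}"
    if "Re \<kappa> = 0" for \<kappa>
    unfolding I_def
    by (intro integrable_integral set_lebesgue_integral_eq_integral(1) absolutely_integrable_shifted_powr[OF q, where B = 1])
       (use p that in \<open>auto intro!: continuous_intros\<close>)
  have "((\<lambda>x::real. (q + of_real x) powr (- p - 1) - 1/2 * ((q + of_real x) powr (- p - 1) * exp (- exp c * of_real x) +
            (q + of_real x) powr (- p - 1) * exp (- exp d * of_real x)))
          has_integral q powr (- p) / p - 1/2 * (I (exp c) + I (exp d))) {0..}"
    by (intro has_integral_diff has_integral_add has_integral_mult_right I J) (simp_all add: c d)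
  also have "(\<lambda>x::real. (q + of_real x) powr (- p - 1) - 1/2 * ((q + of_real x) powr (- p - 1) * exp (- exp c * of_real x) +
            (q + of_real x) powr (- p - 1) * exp (- exp d * of_real x))) =
        (\<lambda>x::real. (q + of_real x) powr (- p - 1) * of_real (1 - cos (a * x)))"
    unfolding c d by (simp add: fun_eq_iff cos_exp_eq field_simps flip: cos_of_real)
  finally have "integral {0..} (\<lambda>x::real. (q + of_real x) powr (- p - 1) * of_real (1 - cos (a * x))) =
       q powr (- p) / p - 1/2 * (I (exp c) + I (exp d))"
    by (rule integral_unique)
  moreover have "p \<noteq> 0"
    using p by auto
  ultimately show ?thesis
    unfolding T using q0 by (simp add: powr_minus field_simps)
qed

section \<open>The explicit bound for the terminant\<close>

text \<open>Moving right pulls the argument towards 0. With z = q + x, the imaginary part of q times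
  the conjugate of z equals x Im q, which gives the sign of sin(Arg q - Arg z); Im z = Im q keeps
  both arguments on the same side of 0.\<close>

lemma Arg_add_of_real_bounds:
  fixes q :: complex and x :: real
  assumes q: "q \<notin> \<real>\<^sub>\<le>\<^sub>0" and x: "x \<ge> 0"
  shows "Arg q \<ge> 0 \<Longrightarrow> 0 \<le> Arg (q + of_real x) \<and> Arg (q + of_real x) \<le> Arg q"
    and "Arg q \<le> 0 \<Longrightarrow> Arg q \<le> Arg (q + of_real x) \<and> Arg (q + of_real x) \<le> 0"
proof -
  define z where "z = q + of_real x"
  have z: "z \<notin> \<real>\<^sub>\<le>\<^sub>0"
    using add_nonneg_not_nonpos_Reals[OF q x] by (simp add: z_def)
  have nz: "norm q > 0" "norm z > 0"
    using q z by auto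
  have lt: "\<bar>Arg q\<bar> < pi" "\<bar>Arg z\<bar> < pi"
    using q z nz by (auto simp: abs_Arg_less_pi_iff)
  have ReIm: "Re q = norm q * cos (Arg q)" "Im q = norm q * sin (Arg q)"
    "Re z = norm z * cos (Arg z)" "Im z = norm z * sin (Arg z)"
    using Re_rcis[of "norm q" "Arg q"] Im_rcis[of "norm q" "Arg q"]
      Re_rcis[of "norm z" "Arg z"] Im_rcis[of "norm z" "Arg z"] by (simp_all only: rcis_cmod_Arg)
  have Imz: "Im z = Im q"
    by (simp add: z_def)
  have "norm q * norm z * sin (Arg q - Arg z) = Im q * Re z - Re q * Im z"
    unfolding ReIm sin_diff by (simp add: algebra_simps)
  also have "\<dots> = x * Im q"
    by (simp add: z_def algebra_simps)
  finally have eq: "norm q * norm z * sin (Arg q - Arg z) = x * Im q" .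
  have sgn: "0 \<le> Arg w \<longleftrightarrow> 0 \<le> Im w" "Arg w \<le> 0 \<longleftrightarrow> Im w \<le> 0" if "\<bar>Arg w\<bar> < pi" "norm w > 0" for w
  proof -
    have Im: "Im w = norm w * sin (Arg w)"
      using Im_rcis[of "norm w" "Arg w"] by (simp only: rcis_cmod_Arg)
    have "Arg w > 0 \<Longrightarrow> sin (Arg w) > 0" "Arg w < 0 \<Longrightarrow> sin (- Arg w) > 0"
      using that by (auto intro!: sin_gt_zero simp del: sin_minus)
    then show "0 \<le> Arg w \<longleftrightarrow> 0 \<le> Im w" "Arg w \<le> 0 \<longleftrightarrow> Im w \<le> 0"
      unfolding Im using that
      by (cases "Arg w" "0::real" rule: linorder_cases; simp add: zero_le_mult_iff mult_le_0_iff)+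
  qed
  show "0 \<le> Arg (q + of_real x) \<and> Arg (q + of_real x) \<le> Arg q" if "Arg q \<ge> 0"
  proof -
    have "Arg z \<ge> 0"
      using that sgn(1)[OF lt(1) nz(1)] sgn(1)[OF lt(2) nz(2)] Imz by simp
    have "sin (Arg q - Arg z) \<ge> 0"
    proof (rule ccontr)
      assume "\<not> sin (Arg q - Arg z) \<ge> 0"
      then have "norm q * norm z * sin (Arg q - Arg z) < 0"
        using nz by (intro mult_pos_neg mult_pos_pos) auto
      moreover have "x * Im q \<ge> 0"
        using that sgn(1)[OF lt(1) nz(1)] x by simp
      ultimately show False
        using eq by linarith
    qed
    moreover have "sin (Arg z - Arg q) > 0" if "Arg z > Arg q"
      using that \<open>Arg z \<ge> 0\<close> \<open>Arg q \<ge> 0\<close> lt by (intro sin_gt_zero) auto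
    ultimately show ?thesis
      using \<open>Arg z \<ge> 0\<close> sin_minus[of "Arg z - Arg q"] by (force simp: z_def)
  qed
  show "Arg q \<le> Arg (q + of_real x) \<and> Arg (q + of_real x) \<le> 0" if "Arg q \<le> 0"
  proof -
    have "Arg z \<le> 0"
      using that sgn(2)[OF lt(1) nz(1)] sgn(2)[OF lt(2) nz(2)] Imz by simp
    have "x * Im q \<le> 0"
      using that sgn(2)[OF lt(1) nz(1)] x by (simp add: mult_nonneg_nonpos)
    then have "sin (Arg q - Arg z) \<le> 0"
      using eq nz by (metis mult_le_0_iff mult_pos_pos not_less)
    moreover have "sin (Arg q - Arg z) > 0" if "Arg z < Arg q"
      using that \<open>Arg z \<le> 0\<close> \<open>Arg q \<le> 0\<close> lt by (intro sin_gt_zero) auto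
    ultimately show ?thesis
      using \<open>Arg z \<le> 0\<close> by (force simp: z_def)
  qed
qed

lemma absolutely_integrable_shifted_powr_real:
  fixes h :: "real \<Rightarrow> real"
  assumes \<rho>: "\<rho> > 0" and \<beta>: "\<beta> < -1"
    and h: "continuous_on {0..} h" and B: "\<And>x. x \<ge> 0 \<Longrightarrow> norm (h x) \<le> B"
  shows "(\<lambda>x. (\<rho> + x) powr \<beta> * h x) absolutely_integrable_on {0..}"
proof (rule measurable_bounded_by_integrable_imp_absolutely_integrable)
  show "(\<lambda>x. (\<rho> + x) powr \<beta> * h x) \<in> borel_measurable (lebesgue_on {0..})"
    using \<rho> by (intro continuous_imp_measurable_on_sets_lebesgue continuous_intros h) auto
  show "(\<lambda>x. (\<rho> + x) powr \<beta> * B) integrable_on {0..}"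
    using has_integral_shifted_powr[OF \<beta> \<rho>]
    by (intro integrable_on_mult_left) (auto simp: integrable_on_def)
qed (use B \<rho> in \<open>auto simp: abs_mult intro!: mult_left_mono\<close>)

text \<open>
  Two integrations by parts trade the cosine for the nonnegative weight \<open>1 - cos\<close> against
  the second derivative of the convex function \<open>(\<rho> + x) powr \<beta>\<close>.
\<close>

lemma integral_shifted_powr_cos_nonneg:
  fixes \<rho> \<beta> a :: real
  assumes \<rho>: "\<rho> > 0" and \<beta>: "\<beta> < -1" and a: "a > 0"
  shows "integral {0..} (\<lambda>x. (\<rho> + x) powr \<beta> * cos (a * x)) \<ge> 0"
proof -
  \<comment> \<open>Taking (1 - cos(a x))/a as the primitive of sin(a x) makes both boundary terms
    vanish at 0 and leaves a nonnegative weight in \<open>v\<close>.\<close>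
  define H where "H = (\<lambda>x. (\<rho> + x) powr \<beta> * sin (a * x) / a - \<beta> * (\<rho> + x) powr (\<beta> - 1) * (1 - cos (a * x)) / a\<^sup>2)"
  define v where "v = (\<lambda>x. \<beta> * (\<beta> - 1) / a\<^sup>2 * ((\<rho> + x) powr (\<beta> - 2) * (1 - cos (a * x))))"
  have u: "(\<lambda>x. (\<rho> + x) powr \<beta> * cos (a * x)) absolutely_integrable_on {0..}"
    using \<rho> \<beta> by (intro absolutely_integrable_shifted_powr_real[where B = 1]) (auto intro!: continuous_intros)
  have bd: "\<bar>1 - cos (a * x)\<bar> \<le> 2" for x
    using cos_ge_minus_one[of "a * x"] cos_le_one[of "a * x"] by linarith
  have v: "v absolutely_integrable_on {0..}"
    unfolding v_def using \<rho> \<beta>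
    by (intro set_integrable_mult_right absolutely_integrable_shifted_powr_real[where B = 2])
       (use bd in \<open>auto intro!: continuous_intros\<close>)
  have "((\<lambda>x. (\<rho> + x) powr \<beta> * cos (a * x) - v x) has_integral 0 - H 0) {0..}"
  proof (rule has_integral_FTC_atLeast)
    show "(\<lambda>x. (\<rho> + x) powr \<beta> * cos (a * x) - v x) absolutely_integrable_on {0..}"
      by (intro set_integral_diff u v)
    show "(H has_vector_derivative (\<rho> + x) powr \<beta> * cos (a * x) - v x) (at x)" if "x \<ge> 0" for x
      unfolding H_def v_def has_real_derivative_iff_has_vector_derivative[symmetric] using \<rho> a that
      by (auto intro!: derivative_eq_intros simp: field_simps power2_eq_square)
    show "(H \<longlongrightarrow> 0) at_top"
    proof (rule Lim_null_comparison)
      show "\<forall>\<^sub>F x in at_top. norm (H x) \<le> (\<rho> + x) powr \<beta> * (1 / a) + (\<rho> + x) powr (\<beta> - 1) * (\<bar>\<beta>\<bar> * 2 / a\<^sup>2)"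
        using eventually_ge_at_top[of 0]
      proof eventually_elim
        case (elim x)
        have "norm (H x) \<le> norm ((\<rho> + x) powr \<beta> * sin (a * x) / a) +
            norm (\<beta> * (\<rho> + x) powr (\<beta> - 1) * (1 - cos (a * x)) / a\<^sup>2)"
          unfolding H_def by (rule norm_triangle_ineq4)
        also have "norm ((\<rho> + x) powr \<beta> * sin (a * x) / a) \<le> (\<rho> + x) powr \<beta> * (1 / a)"
          using a by (auto simp: abs_mult intro!: divide_right_mono mult_left_le)
        also have "norm (\<beta> * (\<rho> + x) powr (\<beta> - 1) * (1 - cos (a * x)) / a\<^sup>2) \<le> (\<rho> + x) powr (\<beta> - 1) * (\<bar>\<beta>\<bar> * 2 / a\<^sup>2)"
          using bd[of x] by (auto simp: abs_mult mult_ac intro!: divide_right_mono mult_left_mono mult_right_mono)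
        finally show ?case
          by simp
      qed
      have 1: "((\<lambda>x. (\<rho> + x) powr \<beta>) \<longlongrightarrow> 0) at_top" "((\<lambda>x. (\<rho> + x) powr (\<beta> - 1)) \<longlongrightarrow> 0) at_top"
        using \<beta> by real_asymp+
      show "((\<lambda>x. (\<rho> + x) powr \<beta> * (1 / a) + (\<rho> + x) powr (\<beta> - 1) * (\<bar>\<beta>\<bar> * 2 / a\<^sup>2)) \<longlongrightarrow> 0) at_top"
        by (intro tendsto_add_zero tendsto_mult_left_zero 1)
    qed
  qed
  then have "integral {0..} (\<lambda>x. (\<rho> + x) powr \<beta> * cos (a * x) - v x) = 0"
    by (simp add: integral_unique H_def)
  then have "integral {0..} (\<lambda>x. (\<rho> + x) powr \<beta> * cos (a * x)) = integral {0..} v"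
    using u v by (subst (asm) integral_diff) (auto intro: set_lebesgue_integral_eq_integral(1))
  also have "\<dots> \<ge> 0"
  proof (rule integral_nonneg)
    have "\<beta> * (\<beta> - 1) \<ge> 0"
      using \<beta> by (intro mult_nonpos_nonpos) auto
    then show "0 \<le> v x" for x
      by (simp add: v_def)
  qed (rule set_lebesgue_integral_eq_integral(1)[OF v])
  finally show ?thesis .
qed

lemma norm_terminant_le:
  fixes p q :: complex and a :: real
  assumes p: "Re p > 0" and q: "q \<notin> \<real>\<^sub>\<le>\<^sub>0" and a: "a > 0"
  shows "norm (terminant p (of_real a * q)) \<le>
           norm p / Re p * (1 / cos (Arg q / 2)) powr (Re p + 1) * max 1 (exp (- Im p * Arg q))"
proof -
  define \<rho> where "\<rho> = norm q"
  define C where "C = (1 / cos (Arg q / 2)) powr (Re p + 1) * max 1 (exp (- Im p * Arg q))"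
  have q0: "q \<noteq> 0" and \<rho>: "\<rho> > 0"
    using q by (auto simp: \<rho>_def)
  have cos: "cos (Arg q / 2) > 0"
    by (rule cos_half_Arg_pos[OF q])
  have le: "norm (q powr p * ((q + of_real x) powr (- p - 1) * of_real (1 - cos (a * x)))) \<le>
      C * \<rho> powr Re p * ((\<rho> + x) powr (- Re p - 1) * (1 - cos (a * x)))" if x: "x \<ge> 0" for x
  proof -
    \<comment> \<open>The two powers contribute exp(- Im p Arg q) and exp(Im p Arg(q + x)). As Arg(q
      + x) lies between 0 and Arg q, the total exponent is linear on that segment and at most the
      larger of its end values - Im p Arg q and 0.\<close>
    have "- Im p * Arg q + Im p * Arg (q + of_real x) \<le> max 0 (- Im p * Arg q)"
    proof (cases "Arg q \<ge> 0")
      case True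
      then show ?thesis
        using Arg_add_of_real_bounds(1)[OF q x True]
        by (cases "Im p \<ge> 0") (auto simp: le_max_iff_disj mult_left_mono mult_nonpos_nonneg)
    next
      case False
      then show ?thesis
        using Arg_add_of_real_bounds(2)[OF q x]
        by (cases "Im p \<ge> 0") (auto simp: le_max_iff_disj mult_left_mono_neg mult_nonneg_nonpos)
    qed
    then have E: "exp (- Im p * Arg q + Im p * Arg (q + of_real x)) \<le> max 1 (exp (- Im p * Arg q))"
      by (cases "- Im p * Arg q \<ge> 0") (auto simp: max_def split: if_splits)
    have "norm (q powr p) * norm ((q + of_real x) powr (- p - 1)) =
       \<rho> powr Re p * (norm (q + of_real x) powr (- Re p - 1) * exp (- Im p * Arg q + Im p * Arg (q + of_real x)))"
      unfolding norm_powr_complex \<rho>_def exp_add by (simp add: mult_ac)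
    also have "\<dots> \<le> \<rho> powr Re p * (((\<rho> + x) * cos (Arg q / 2)) powr (- Re p - 1) * max 1 (exp (- Im p * Arg q)))"
      using norm_add_of_real_ge[OF q x] \<rho> x cos p
      by (intro mult_left_mono mult_mono E powr_mono2') (auto simp: \<rho>_def intro!: mult_pos_pos add_pos_nonneg)
    also have "((\<rho> + x) * cos (Arg q / 2)) powr (- Re p - 1) =
        (\<rho> + x) powr (- Re p - 1) * (1 / cos (Arg q / 2)) powr (Re p + 1)"
    proof -
      have "cos (Arg q / 2) powr (- Re p - 1) = inverse (cos (Arg q / 2) powr (Re p + 1))"
        by (simp add: powr_minus[symmetric])
      then show ?thesis
        using cos \<rho> x by (simp add: powr_mult powr_divide inverse_eq_divide)
    qed
    finally have "norm (q powr p) * norm ((q + of_real x) powr (- p - 1)) \<le> C * \<rho> powr Re p * (\<rho> + x) powr (- Re p - 1)"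
      by (simp add: C_def mult_ac)
    then have "norm (q powr p) * norm ((q + of_real x) powr (- p - 1)) * (1 - cos (a * x)) \<le>
        C * \<rho> powr Re p * (\<rho> + x) powr (- Re p - 1) * (1 - cos (a * x))"
      by (intro mult_right_mono) auto
    then show ?thesis
      unfolding norm_mult norm_of_real by (simp add: mult_ac)
  qed
  have cont: "continuous_on {0..} (\<lambda>x::real. 1 - cos (a * x))" "continuous_on {0..} (\<lambda>x::real. complex_of_real (1 - cos (a * x)))"
    by (intro continuous_intros)+
  have bd: "\<bar>1 - cos (a * x)\<bar> \<le> 2" for x
    using cos_ge_minus_one[of "a * x"] cos_le_one[of "a * x"] by linarith
  have int: "(\<lambda>x::real. (q + of_real x) powr (- p - 1) * of_real (1 - cos (a * x))) absolutely_integrable_on {0..}"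
    by (rule absolutely_integrable_shifted_powr[OF q _ cont(2), where B = 2])
       (use p bd in \<open>auto simp only: norm_of_real minus_complex.sel uminus_complex.sel one_complex.sel\<close>)
  have intr: "(\<lambda>x::real. (\<rho> + x) powr (- Re p - 1) * (1 - cos (a * x))) integrable_on {0..}"
    by (intro set_lebesgue_integral_eq_integral(1) absolutely_integrable_shifted_powr_real[OF \<rho> _ cont(1), where B = 2])
       (use p bd in auto)
  have ints: "((\<lambda>x. (\<rho> + x) powr (- Re p - 1)) has_integral \<rho> powr (- Re p) / Re p) {0..}"
    using has_integral_shifted_powr[of "- Re p - 1" \<rho>] p \<rho> by simp
  have intc: "(\<lambda>x. (\<rho> + x) powr (- Re p - 1) * cos (a * x)) integrable_on {0..}"
    by (intro set_lebesgue_integral_eq_integral(1) absolutely_integrable_shifted_powr_real[OF \<rho>, where B = 1])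
       (use p in \<open>auto intro!: continuous_intros\<close>)
  have "norm (terminant p (of_real a * q)) =
      norm p * norm (integral {0..} (\<lambda>x::real. q powr p * ((q + of_real x) powr (- p - 1) * of_real (1 - cos (a * x)))))"
    unfolding terminant_eq_integral[OF assms] by (simp add: norm_mult)
  also have "norm (integral {0..} (\<lambda>x::real. q powr p * ((q + of_real x) powr (- p - 1) * of_real (1 - cos (a * x))))) \<le>
      integral {0..} (\<lambda>x. C * \<rho> powr Re p * ((\<rho> + x) powr (- Re p - 1) * (1 - cos (a * x))))"
    by (intro integral_norm_bound_integral integrable_on_mult_right set_lebesgue_integral_eq_integral(1)[OF int] intr)
       (use le in auto)
  also have "\<dots> = C * \<rho> powr Re p * (integral {0..} (\<lambda>x. (\<rho> + x) powr (- Re p - 1)) -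
       integral {0..} (\<lambda>x. (\<rho> + x) powr (- Re p - 1) * cos (a * x)))"
    using ints intc by (subst integral_diff[symmetric]) (auto simp: algebra_simps simp flip: integral_mult_right)
  also have "\<dots> \<le> C * \<rho> powr Re p * (\<rho> powr (- Re p) / Re p - 0)"
    using integral_shifted_powr_cos_nonneg[OF \<rho> _ a, of "- Re p - 1"] p ints
    by (intro mult_left_mono diff_mono) (auto simp: C_def integral_unique)
  also have "\<dots> = C / Re p"
    using \<rho> by (simp add: powr_minus field_simps)
  finally have "norm (terminant p (of_real a * q)) \<le> norm p * (C / Re p)"
    by (simp add: mult_left_mono)
  then show ?thesis
    by (simp add: C_def mult_ac)
qed

section \<open>Periodic Euler polynomials\<close>

definition odd_pi :: "nat \<Rightarrow> real" where
  "odd_pi r = (2 * real r + 1) * pi"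

text \<open>
  Up to sign and normalisation, \<open>euler_wave N\<close> is the periodic Euler polynomial of degree
  \<open>2 N + 1\<close>, shifted by the constant that makes it vanish at \<open>0\<close>.
\<close>

definition euler_wave :: "nat \<Rightarrow> real \<Rightarrow> real" where
  "euler_wave N x = (\<Sum>r. 4 * (1 - cos (odd_pi r * x)) / odd_pi r ^ (2 * N + 2))"

definition euler_wave' :: "nat \<Rightarrow> real \<Rightarrow> real" where
  "euler_wave' N x = (\<Sum>r. 4 * sin (odd_pi r * x) / odd_pi r ^ (2 * N + 1))"

text \<open>The mean value of \<open>euler_wave N\<close> over a period; up to sign it is
  E_{2N+1}(0)/(2N+1)!, as \<open>euler_poly_odd_0\<close> shows.\<close>

definition euler_coeff :: "nat \<Rightarrow> real" where
  "euler_coeff N = (\<Sum>r. 4 / odd_pi r ^ (2 * N + 2))"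

lemma odd_pi_ge: "odd_pi r \<ge> real r + 1"
proof -
  have "real r + 1 \<le> (2 * real r + 1) * 1"
    by simp
  also have "\<dots> \<le> (2 * real r + 1) * pi"
    using pi_ge_two by (intro mult_left_mono) auto
  finally show ?thesis
    by (simp add: odd_pi_def)
qed

lemma odd_pi_pos [simp]: "odd_pi r > 0"
  using odd_pi_ge[of r] by linarith

lemma odd_pi_neq_0 [simp]: "odd_pi r \<noteq> 0"
  using odd_pi_pos[of r] by linarith

lemma abs_odd_pi [simp]: "\<bar>odd_pi r\<bar> = odd_pi r"
  by (simp add: less_imp_le)

lemma summable_odd_pi:
  assumes "k \<ge> 2"
  shows "summable (\<lambda>r. c / odd_pi r ^ k)"
proof -
  have "summable (\<lambda>n. inverse (real (Suc n) ^ 2))"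
    using inverse_power_summable[of 2, where ?'a = real] by (subst summable_Suc_iff) auto
  moreover have "norm (1 / odd_pi r ^ k) \<le> inverse (real (Suc r) ^ 2)" for r
  proof -
    have "real (Suc r) ^ 2 \<le> real (Suc r) ^ k"
      using assms by (intro power_increasing) auto
    also have "\<dots> \<le> odd_pi r ^ k"
      using odd_pi_ge[of r] by (intro power_mono) auto
    finally have "1 / odd_pi r ^ k \<le> 1 / real (Suc r) ^ 2"
      by (intro divide_left_mono) auto
    then show ?thesis
      by (simp add: inverse_eq_divide power_abs)
  qed
  ultimately have "summable (\<lambda>r. 1 / odd_pi r ^ k)"
    by (rule summable_comparison_test')
  from summable_mult[OF this, of c] show ?thesis
    by simp
qed

lemma abs_one_minus_cos_le: "\<bar>1 - cos (x::real)\<bar> \<le> 2"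
  using cos_ge_minus_one[of x] cos_le_one[of x] by linarith

lemma abs_euler_wave_term_le: "\<bar>4 * (1 - cos x) / odd_pi r ^ k\<bar> \<le> 8 / odd_pi r ^ k"
proof -
  have "\<bar>4 * (1 - cos x)\<bar> = 4 * \<bar>1 - cos x\<bar>"
    by (simp only: abs_mult abs_numeral)
  also have "\<dots> \<le> 4 * 2"
    by (intro mult_left_mono abs_one_minus_cos_le) simp
  finally have "\<bar>4 * (1 - cos x)\<bar> \<le> 8"
    by simp
  then show ?thesis
    unfolding abs_divide power_abs abs_odd_pi
    by (rule divide_right_mono) (simp add: less_imp_le)
qed

lemma summable_euler_wave: "summable (\<lambda>r. 4 * (1 - cos (odd_pi r * x)) / odd_pi r ^ (2 * N + 2))"
proof (rule summable_comparison_test')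
  show "summable (\<lambda>r. 8 / odd_pi r ^ (2 * N + 2))"
    by (rule summable_odd_pi) auto
qed (use abs_euler_wave_term_le in \<open>simp only: real_norm_def\<close>)

lemma continuous_on_suminf:
  fixes f :: "nat \<Rightarrow> 'a::topological_space \<Rightarrow> 'b::banach"
  assumes "\<And>n. continuous_on A (f n)" "\<And>n x. x \<in> A \<Longrightarrow> norm (f n x) \<le> M n" "summable M"
  shows "continuous_on A (\<lambda>x. \<Sum>n. f n x)"
proof (rule uniform_limit_theorem)
  show "uniform_limit A (\<lambda>n x. \<Sum>i<n. f i x) (\<lambda>x. \<Sum>n. f n x) sequentially"
    by (rule Weierstrass_m_test) (use assms in auto)
qed (use assms in \<open>auto intro!: continuous_intros always_eventually\<close>)

lemma continuous_on_euler_wave: "continuous_on A (euler_wave N)"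
proof -
  have "continuous_on UNIV (\<lambda>x. \<Sum>r. 4 * (1 - cos (odd_pi r * x)) / odd_pi r ^ (2 * N + 2))"
  proof (rule continuous_on_suminf)
    show "summable (\<lambda>r. 8 / odd_pi r ^ (2 * N + 2))"
      by (rule summable_odd_pi) auto
    show "norm (4 * (1 - cos (odd_pi r * x)) / odd_pi r ^ (2 * N + 2)) \<le> 8 / odd_pi r ^ (2 * N + 2)" for r x
      using abs_euler_wave_term_le by (simp only: real_norm_def)
  qed (auto intro!: continuous_intros)
  then show ?thesis
    unfolding euler_wave_def by (rule continuous_on_subset) auto
qed

lemma euler_wave_bounds: "0 \<le> euler_wave N x" "euler_wave N x \<le> 2 * euler_coeff N"
proof -
  show "0 \<le> euler_wave N x"
    unfolding euler_wave_def by (intro suminf_nonneg summable_euler_wave) (simp add: less_imp_le)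
  have "euler_wave N x \<le> (\<Sum>r. 2 * (4 / odd_pi r ^ (2 * N + 2)))"
    unfolding euler_wave_def
  proof (intro suminf_le summable_euler_wave summable_mult summable_odd_pi)
    show "4 * (1 - cos (odd_pi r * x)) / odd_pi r ^ (2 * N + 2) \<le> 2 * (4 / odd_pi r ^ (2 * N + 2))" for r
      using abs_le_D1[OF abs_euler_wave_term_le[of "odd_pi r * x" r "2 * N + 2"]] by simp
  qed auto
  also have "\<dots> = 2 * euler_coeff N"
    unfolding euler_coeff_def by (intro suminf_mult summable_odd_pi) auto
  finally show "euler_wave N x \<le> 2 * euler_coeff N" .
qed

lemma euler_wave_0 [simp]: "euler_wave N 0 = 0" and euler_wave'_0 [simp]: "euler_wave' N 0 = 0"
  by (simp_all add: euler_wave_def euler_wave'_def)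

text \<open>For positive order the differentiated series is dominated by the cubes of 1 /
  \<open>odd_pi r\<close>. At order 0 it is the Fourier series of a square wave and is not dominated
  in this way; that case is treated by Abel summation.\<close>

lemma DERIV_euler_wave:
  assumes "N > 0"
  shows "(euler_wave N has_field_derivative euler_wave' N x) (at x)"
proof -
  have "((\<lambda>x. \<Sum>r. 4 * (1 - cos (odd_pi r * x)) / odd_pi r ^ (2 * N + 2)) has_field_derivative
          (\<Sum>r. 4 * sin (odd_pi r * x) / odd_pi r ^ (2 * N + 1))) (at x)"
  proof (rule has_field_derivative_series'(2)[where S = UNIV and ?x0.0 = 0])
    show "uniformly_convergent_on UNIV (\<lambda>n x. \<Sum>r<n. 4 * sin (odd_pi r * x) / odd_pi r ^ (2 * N + 1))"
    proof (rule Weierstrass_m_test')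
      show "summable (\<lambda>r. 4 / odd_pi r ^ (2 * N + 1))"
        using assms by (intro summable_odd_pi) auto
    qed (auto simp: abs_mult less_imp_le intro!: divide_right_mono)
    show "((\<lambda>x. 4 * (1 - cos (odd_pi r * x)) / odd_pi r ^ (2 * N + 2)) has_field_derivative
        4 * sin (odd_pi r * x) / odd_pi r ^ (2 * N + 1)) (at x within UNIV)" for r x
      using odd_pi_pos[of r] by (auto intro!: derivative_eq_intros simp: field_simps simp del: odd_pi_pos)
  qed auto
  then show ?thesis
    by (simp add: euler_wave_def[abs_def] euler_wave'_def)
qed

text \<open>Differentiating twice lowers the order by one but turns 1 - cos into cos. The constant
  that appears is what produces the successive terms of the asymptotic expansion.\<close>

lemma DERIV_euler_wave': "(euler_wave' (Suc N) has_field_derivative euler_coeff N - euler_wave N x) (at x)"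
proof -
  have "((\<lambda>x. \<Sum>r. 4 * sin (odd_pi r * x) / odd_pi r ^ (2 * Suc N + 1)) has_field_derivative
          (\<Sum>r. 4 * cos (odd_pi r * x) / odd_pi r ^ (2 * N + 2))) (at x)"
  proof (rule has_field_derivative_series'(2)[where S = UNIV and ?x0.0 = 0])
    show "uniformly_convergent_on UNIV (\<lambda>n x. \<Sum>r<n. 4 * cos (odd_pi r * x) / odd_pi r ^ (2 * N + 2))"
    proof (rule Weierstrass_m_test')
      show "summable (\<lambda>r. 4 / odd_pi r ^ (2 * N + 2))"
        by (intro summable_odd_pi) auto
    qed (auto simp: abs_mult less_imp_le intro!: divide_right_mono)
    show "((\<lambda>x. 4 * sin (odd_pi r * x) / odd_pi r ^ (2 * Suc N + 1)) has_field_derivative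
        4 * cos (odd_pi r * x) / odd_pi r ^ (2 * N + 2)) (at x within UNIV)" for r x
      using odd_pi_pos[of r] by (auto intro!: derivative_eq_intros simp: field_simps simp del: odd_pi_pos)
  qed auto
  moreover have "(\<Sum>r. 4 * cos (odd_pi r * x) / odd_pi r ^ (2 * N + 2)) = euler_coeff N - euler_wave N x"
    unfolding euler_coeff_def euler_wave_def
    by (subst suminf_diff[OF summable_odd_pi summable_euler_wave])
       (auto simp: algebra_simps diff_divide_distrib intro!: suminf_cong)
  ultimately show ?thesis
    by (simp add: euler_wave'_def[abs_def])
qed

lemma abs_euler_wave'_le:
  assumes "N > 0"
  shows "\<bar>euler_wave' N x\<bar> \<le> (\<Sum>r. 4 / odd_pi r ^ (2 * N + 1))"
proof -
  have *: "norm (4 * sin (odd_pi r * x) / odd_pi r ^ (2 * N + 1)) \<le> 4 / odd_pi r ^ (2 * N + 1)" for r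
    by (auto simp: abs_mult power_abs less_imp_le intro!: divide_right_mono)
  have s: "summable (\<lambda>r. 4 / odd_pi r ^ (2 * N + 1))"
    using assms by (intro summable_odd_pi) auto
  have n: "summable (\<lambda>r. norm (4 * sin (odd_pi r * x) / odd_pi r ^ (2 * N + 1)))"
    by (rule summable_comparison_test'[OF s]) (use * in simp)
  show ?thesis
    unfolding euler_wave'_def real_norm_def[symmetric]
    by (rule order_trans[OF summable_norm[OF n] suminf_le[OF * n s]])
qed

text \<open>
  Abel summation: inside the unit disc the differentiated series is the imaginary part of
  \<open>Ln (1 + z) - Ln (1 - z)\<close>, and its boundary value is constant on the upper half circle.
\<close>

lemma square_wave_abel_sums:
  assumes \<rho>: "0 \<le> \<rho>" "\<rho> < 1"
  defines "z \<equiv> \<lambda>x. of_real \<rho> * cis (pi * x)"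
  shows "(\<lambda>r. \<rho> ^ (2 * r + 1) * (4 * sin (odd_pi r * x) / odd_pi r)) sums
           (2 / pi * (Im (Ln (1 + z x)) - Im (Ln (1 - z x))))"
proof -
  have nz: "norm (z x) < 1"
    using \<rho> by (simp add: z_def norm_mult)
  \<comment> \<open>Even powers cancel, including index 0, where both quotients are 0 because
    division by zero yields 0.\<close>
  have "(\<lambda>n. - ((- z x) ^ n) / of_nat n - - ((- (- z x)) ^ n) / of_nat n) sums (Ln (1 + z x) - Ln (1 + (- z x)))"
    using nz by (intro sums_diff Ln_series') auto
  also have "(\<lambda>n. - ((- z x) ^ n) / of_nat n - - ((- (- z x)) ^ n) / of_nat n) =
      (\<lambda>n. if odd n then 2 * z x ^ n / of_nat n else 0)"
    by (auto simp: fun_eq_iff)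
  finally have "(\<lambda>r. if odd (2 * r + 1) then 2 * z x ^ (2 * r + 1) / of_nat (2 * r + 1) else 0) sums (Ln (1 + z x) - Ln (1 - z x))"
    by (subst sums_mono_reindex) (auto simp: strict_mono_def elim!: oddE)
  from sums_Im[OF this] have "(\<lambda>r. Im (2 * z x ^ (2 * r + 1) / of_nat (2 * r + 1))) sums (Im (Ln (1 + z x)) - Im (Ln (1 - z x)))"
    by simp
  from sums_mult[OF this, of "2 / pi"]
  have "(\<lambda>r. 2 / pi * Im (2 * z x ^ (2 * r + 1) / of_nat (2 * r + 1))) sums
           (2 / pi * (Im (Ln (1 + z x)) - Im (Ln (1 - z x))))" .
  moreover have "2 / pi * Im (2 * z x ^ (2 * r + 1) / of_nat (2 * r + 1)) =
      \<rho> ^ (2 * r + 1) * (4 * sin (odd_pi r * x) / odd_pi r)" for r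
  proof -
    have "2 * z x ^ (2 * r + 1) / of_nat (2 * r + 1) = of_real (2 * \<rho> ^ (2 * r + 1) / real (2 * r + 1)) * cis (odd_pi r * x)"
      unfolding z_def power_mult_distrib Complex.DeMoivre by (simp add: odd_pi_def mult_ac add_ac)
    then have "Im (2 * z x ^ (2 * r + 1) / of_nat (2 * r + 1)) = 2 * \<rho> ^ (2 * r + 1) / real (2 * r + 1) * sin (odd_pi r * x)"
      by (simp only: times_complex.sel Re_complex_of_real Im_complex_of_real cis.sel mult_zero_left add_0_right)
    then show ?thesis
      by (simp add: odd_pi_def field_simps)
  qed
  ultimately show ?thesis
    by simp
qed

lemma Im_Ln_one_plus_cis:
  assumes "- pi < x" "x < pi"
  shows "Im (Ln (1 + cis x)) = x / 2"
proof -
  have eq: "1 + cis x = rcis (2 * cos (x / 2)) (x / 2)"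
    using cos_double_cos[of "x / 2"] sin_double[of "x / 2"]
    by (auto simp: complex_eq_iff rcis_def power2_eq_square)
  have c: "2 * cos (x / 2) > 0"
    using assms by (auto intro!: cos_gt_zero_pi)
  then have "1 + cis x \<noteq> 0"
    unfolding eq by simp
  moreover have "Arg (1 + cis x) = x / 2"
    using assms by (intro Arg_unique'[OF c _ eq]) auto
  ultimately show ?thesis
    by (simp add: Arg_eq_Im_Ln)
qed

text \<open>Damping the series by powers of \<open>\<rho>\<close> < 1 allows termwise
  differentiation. The derivatives are bounded by 2 and tend to 1 on the open unit interval, so
  dominated convergence gives the undamped sum as the integral of 1.\<close>

lemma euler_wave_0_Icc:
  assumes x: "0 \<le> x" "x \<le> 1"
  shows "euler_wave 0 x = x"
proof -
  define F where "F = (\<lambda>\<rho> x. \<Sum>r. \<rho> ^ (2 * r + 1) * (4 * (1 - cos (odd_pi r * x)) / odd_pi r ^ 2))"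
  define z where "z = (\<lambda>\<rho> x. complex_of_real \<rho> * cis (pi * x))"
  define \<theta> where "\<theta> = (\<lambda>\<rho> x. 2 / pi * (Im (Ln (1 + z \<rho> x)) - Im (Ln (1 - z \<rho> x))))"
  define \<rho> where "\<rho> = (\<lambda>k. 1 - 1 / (real k + 1))"
  have \<rho>: "0 \<le> \<rho> k" "\<rho> k < 1" for k
    by (auto simp: \<rho>_def field_simps)
  have \<rho>_lim: "\<rho> \<longlonglongrightarrow> 1"
    unfolding \<rho>_def by real_asymp
  have F_deriv: "(F (\<rho> k) has_field_derivative \<theta> (\<rho> k) t) (at t)" for k t
  proof -
    have "((\<lambda>x. \<Sum>r. \<rho> k ^ (2 * r + 1) * (4 * (1 - cos (odd_pi r * x)) / odd_pi r ^ 2)) has_field_derivative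
            (\<Sum>r. \<rho> k ^ (2 * r + 1) * (4 * sin (odd_pi r * t) / odd_pi r))) (at t)"
    proof (rule has_field_derivative_series'(2)[where S = UNIV and ?x0.0 = 0])
      show "uniformly_convergent_on UNIV (\<lambda>n x. \<Sum>r<n. \<rho> k ^ (2 * r + 1) * (4 * sin (odd_pi r * x) / odd_pi r))"
      proof (rule Weierstrass_m_test')
        have "summable (\<lambda>r. (\<rho> k ^ 2) ^ r)"
          using \<rho>[of k] by (intro summable_geometric) (auto simp: abs_square_less_1)
        from summable_mult[OF this, of "\<rho> k * 4"]
        have "summable (\<lambda>r. \<rho> k * 4 * (\<rho> k ^ 2) ^ r)" .
        also have "(\<lambda>r. \<rho> k * 4 * (\<rho> k ^ 2) ^ r) = (\<lambda>r. \<rho> k ^ (2 * r + 1) * 4)"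
          by (simp add: fun_eq_iff power_mult[symmetric])
        finally show "summable (\<lambda>r. \<rho> k ^ (2 * r + 1) * 4)" .
        fix r x
        have "\<bar>sin (odd_pi r * x)\<bar> / odd_pi r \<le> 1 / 1"
          using odd_pi_ge[of r] by (intro frac_le) auto
        then show "norm (\<rho> k ^ (2 * r + 1) * (4 * sin (odd_pi r * x) / odd_pi r)) \<le> \<rho> k ^ (2 * r + 1) * 4"
          using \<rho>[of k] mult_left_mono[of "\<bar>sin (odd_pi r * x)\<bar> / odd_pi r" 1 "\<rho> k ^ (2 * r + 1) * 4"]
          by (auto simp: abs_mult)
      qed
      show "((\<lambda>x. \<rho> k ^ (2 * r + 1) * (4 * (1 - cos (odd_pi r * x)) / odd_pi r ^ 2)) has_field_derivative
          \<rho> k ^ (2 * r + 1) * (4 * sin (odd_pi r * x) / odd_pi r)) (at x within UNIV)" for r x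
        using odd_pi_pos[of r] by (auto intro!: derivative_eq_intros simp: field_simps power2_eq_square simp del: odd_pi_pos)
    qed auto
    also have "(\<Sum>r. \<rho> k ^ (2 * r + 1) * (4 * sin (odd_pi r * t) / odd_pi r)) = \<theta> (\<rho> k) t"
      unfolding \<theta>_def z_def using square_wave_abel_sums[OF \<rho>, of k t] by (rule sums_unique[symmetric])
    finally show ?thesis
      by (simp add: F_def)
  qed
  \<comment> \<open>The open interval avoids t = 0 and t = 1, where 1 - cis(pi t) or 1 + cis(pi t)
    is 0 and the logarithm is discontinuous.\<close>
  have "((\<lambda>t. 1) has_integral euler_wave 0 x) {0<..<x}"
  proof (rule has_integral_dominated_convergence)
    show "(\<theta> (\<rho> k) has_integral F (\<rho> k) x - F (\<rho> k) 0) {0<..<x}" for k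
      unfolding has_integral_Icc_iff_Ioo[symmetric]
      using x F_deriv[of k]
      by (intro fundamental_theorem_of_calculus)
         (auto simp flip: has_real_derivative_iff_has_vector_derivative intro: has_field_derivative_at_within)
    show "(\<lambda>t. 2 :: real) integrable_on {0<..<x}"
      unfolding integrable_on_Icc_iff_Ioo[symmetric] by (rule integrable_const_ivl)
    show "\<forall>t\<in>{0<..<x}. norm (\<theta> (\<rho> k) t) \<le> 2" for k
    proof
      fix t assume "t \<in> {0<..<x}"
      have "\<bar>Re (z (\<rho> k) t)\<bar> \<le> norm (z (\<rho> k) t)"
        by (rule abs_Re_le_cmod)
      also have "\<dots> < 1"
        using \<rho>[of k] by (simp add: z_def norm_mult)
      \<comment> \<open>Both 1 + z and 1 - z lie in the right half-plane, so the two arguments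
        differ by less than pi.\<close>
      finally have "\<bar>Im (Ln (1 + z (\<rho> k) t))\<bar> < pi / 2" "\<bar>Im (Ln (1 - z (\<rho> k) t))\<bar> < pi / 2"
        by (intro Re_Ln_pos_lt_imp; simp)+
      then have "\<bar>Im (Ln (1 + z (\<rho> k) t)) - Im (Ln (1 - z (\<rho> k) t))\<bar> \<le> pi"
        by linarith
      then show "norm (\<theta> (\<rho> k) t) \<le> 2"
        by (auto simp: \<theta>_def abs_mult field_simps)
    qed
    show "\<forall>t\<in>{0<..<x}. (\<lambda>k. \<theta> (\<rho> k) t) \<longlonglongrightarrow> 1"
    proof
      fix t assume t: "t \<in> {0<..<x}"
      have "(\<lambda>k. z (\<rho> k) t) \<longlonglongrightarrow> of_real 1 * cis (pi * t)"
        unfolding z_def by (intro tendsto_intros \<rho>_lim)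
      then have z_lim: "(\<lambda>k. z (\<rho> k) t) \<longlonglongrightarrow> cis (pi * t)"
        by simp
      have "sin (pi * t) > 0"
        using t x by (intro sin_gt_zero) auto
      then have "1 + cis (pi * t) \<notin> \<real>\<^sub>\<le>\<^sub>0" "1 - cis (pi * t) \<notin> \<real>\<^sub>\<le>\<^sub>0"
        by (auto simp: complex_nonpos_Reals_iff)
      then have "(\<lambda>k. \<theta> (\<rho> k) t) \<longlonglongrightarrow> 2 / pi * (Im (Ln (1 + cis (pi * t))) - Im (Ln (1 - cis (pi * t))))"
        unfolding \<theta>_def by (intro tendsto_intros z_lim)
      moreover have "Im (Ln (1 + cis (pi * t))) = pi * t / 2"
        using t x by (intro Im_Ln_one_plus_cis) (auto intro: less_le_trans[of _ 0])
      \<comment> \<open>The two arguments are pi t / 2 and (pi t - pi) / 2; their difference pi / 2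
        does not depend on t.\<close>
      moreover have "1 - cis (pi * t) = 1 + cis (pi * t - pi)"
        by (simp add: complex_eq_iff)
      then have "Im (Ln (1 - cis (pi * t))) = (pi * t - pi) / 2"
        using t x by (simp only:) (intro Im_Ln_one_plus_cis, auto intro: less_le_trans[of _ 0])
      ultimately show "(\<lambda>k. \<theta> (\<rho> k) t) \<longlonglongrightarrow> 1"
        by (simp add: field_simps)
    qed
    \<comment> \<open>The quadratic denominators dominate uniformly up to \<open>\<rho>\<close> = 1,
      so the damped sums tend to the undamped one.\<close>
    have "continuous_on {0..1} (\<lambda>\<rho>. F \<rho> x)"
      unfolding F_def
    proof (rule continuous_on_suminf)
      show "summable (\<lambda>r. 8 / odd_pi r ^ 2)"
        by (rule summable_odd_pi) auto
      show "norm (\<rho> ^ (2 * r + 1) * (4 * (1 - cos (odd_pi r * x)) / odd_pi r ^ 2)) \<le> 8 / odd_pi r ^ 2"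
        if "\<rho> \<in> {0..1}" for r \<rho>
      proof -
        have "\<bar>\<rho> ^ (2 * r + 1)\<bar> \<le> 1"
          using that by (auto simp: power_abs intro!: power_le_one mult_le_one)
        moreover have "\<bar>4 * (1 - cos (odd_pi r * x)) / odd_pi r ^ 2\<bar> \<le> 8 / odd_pi r ^ 2"
          by (rule abs_euler_wave_term_le)
        ultimately show ?thesis
          unfolding real_norm_def abs_mult[of "\<rho> ^ (2 * r + 1)"]
          by (metis abs_ge_zero mult_left_le_one_le order_trans)
      qed
    qed (auto intro!: continuous_intros)
    then have "(\<lambda>k. F (\<rho> k) x) \<longlonglongrightarrow> F 1 x"
      using \<rho> by (intro continuous_on_tendsto_compose[OF _ \<rho>_lim]) (auto simp: less_imp_le intro!: always_eventually)
    moreover have "F r 0 = 0" for r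
      by (simp add: F_def)
    moreover have "F 1 x = euler_wave 0 x"
      by (simp add: F_def euler_wave_def power2_eq_square)
    ultimately show "(\<lambda>k. F (\<rho> k) x - F (\<rho> k) 0) \<longlonglongrightarrow> euler_wave 0 x"
      by simp
  qed
  then have "((\<lambda>t. 1 :: real) has_integral euler_wave 0 x) {0..x}"
    by (simp add: has_integral_Icc_iff_Ioo)
  moreover have "((\<lambda>t. 1 :: real) has_integral x) {0..x}"
    using has_integral_const_real[of "1 :: real" 0 x] x by simp
  ultimately show ?thesis
    by (rule has_integral_unique)
qed

lemma euler_wave_periodic: "euler_wave N (x + 2 * real m) = euler_wave N x"
proof -
  have "cos (odd_pi r * (x + 2 * real m)) = cos (odd_pi r * x)" for r
  proof -
    have "odd_pi r * (x + 2 * real m) = odd_pi r * x + 2 * real ((2 * r + 1) * m) * pi"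
      by (simp add: odd_pi_def algebra_simps)
    then show ?thesis
      by (simp only: cos_add cos_2npi sin_2npi mult_1_right mult_zero_right diff_zero)
  qed
  then show ?thesis
    by (simp add: euler_wave_def)
qed

lemma euler_wave_minus: "euler_wave N (- x) = euler_wave N x"
  by (simp add: euler_wave_def)

lemma euler_wave_0_unit_interval:
  assumes "real n \<le> x" "x \<le> real n + 1"
  shows "euler_wave 0 x = (if even n then x - real n else real n + 1 - x)"
proof (cases "even n")
  case True
  then obtain m where "n = 2 * m"
    by (elim evenE)
  then show ?thesis
    using assms euler_wave_periodic[of 0 "x - real n" m] euler_wave_0_Icc[of "x - real n"] by simp
next
  case False
  \<comment> \<open>Evenness and a shift by 2 (m + 1) carry \<open>x\<close> to n + 1 - x, which
    lies in the unit interval.\<close>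
  then obtain m where "n = 2 * m + 1"
    by (elim oddE)
  then show ?thesis
    using assms euler_wave_periodic[of 0 "- x" "m + 1"] euler_wave_minus[of 0 x]
      euler_wave_0_Icc[of "real n + 1 - x"] by (simp add: algebra_simps)
qed

section \<open>Boole summation\<close>

lemma absolutely_integrable_mult_euler_wave:
  fixes g :: "real \<Rightarrow> complex"
  assumes "g absolutely_integrable_on {0..}"
  shows "(\<lambda>x. g x * of_real (euler_wave N x)) absolutely_integrable_on {0..}"
proof -
  have "(\<lambda>x. of_real (euler_wave N x) * g x) absolutely_integrable_on {0..}"
  proof (rule absolutely_integrable_bounded_measurable_product[OF bilinear_times _ _ _ assms])
    show "(\<lambda>x. complex_of_real (euler_wave N x)) \<in> borel_measurable (lebesgue_on {0..})"
      by (intro continuous_imp_measurable_on_sets_lebesgue continuous_intros continuous_on_euler_wave) auto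
    show "bounded ((\<lambda>x. complex_of_real (euler_wave N x)) ` {0..})"
      unfolding bounded_iff using euler_wave_bounds by (intro exI[of _ "2 * euler_coeff N"]) auto
  qed auto
  then show ?thesis
    by (simp add: mult.commute)
qed

text \<open>The wave of order 0 is linear here with slope 1 or -1, so \<open>f1\<close> times the
  wave, minus or plus \<open>f\<close>, is a primitive. When intervals are joined, the
  \<open>f1\<close> terms cancel by continuity, while the change of slope doubles the values of
  \<open>f\<close> with alternating sign.\<close>

lemma has_integral_euler_wave_unit_interval:
  fixes f f1 f2 :: "real \<Rightarrow> complex"
  assumes f: "\<And>x. x \<ge> 0 \<Longrightarrow> (f has_vector_derivative f1 x) (at x)"
    and f1: "\<And>x. x \<ge> 0 \<Longrightarrow> (f1 has_vector_derivative f2 x) (at x)"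
  shows "((\<lambda>x. f2 x * of_real (euler_wave 0 x)) has_integral
           (if even n then f1 (real n + 1) - f (real n + 1) + f (real n)
            else f (real n + 1) - f (real n) - f1 (real n))) {real n..real n + 1}"
proof (cases "even n")
  case True
  have "((\<lambda>x. f2 x * of_real (x - real n)) has_integral
      (f1 (real n + 1) * of_real (real n + 1 - real n) - f (real n + 1)) -
      (f1 (real n) * of_real (real n - real n) - f (real n))) {real n..real n + 1}"
    by (rule fundamental_theorem_of_calculus)
       (auto intro!: derivative_eq_intros has_vector_derivative_at_within[OF f] has_vector_derivative_at_within[OF f1])
  also have "?this \<longleftrightarrow> ((\<lambda>x. f2 x * of_real (euler_wave 0 x)) has_integral
      (f1 (real n + 1) * of_real (real n + 1 - real n) - f (real n + 1)) -
      (f1 (real n) * of_real (real n - real n) - f (real n))) {real n..real n + 1}"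
    using True by (intro has_integral_cong) (simp add: euler_wave_0_unit_interval[of n])
  finally show ?thesis
    using True by simp
next
  case False
  have "((\<lambda>x. f2 x * of_real (real n + 1 - x)) has_integral
      (f1 (real n + 1) * of_real (real n + 1 - (real n + 1)) + f (real n + 1)) -
      (f1 (real n) * of_real (real n + 1 - real n) + f (real n))) {real n..real n + 1}"
    by (rule fundamental_theorem_of_calculus)
       (auto intro!: derivative_eq_intros has_vector_derivative_at_within[OF f] has_vector_derivative_at_within[OF f1])
  also have "?this \<longleftrightarrow> ((\<lambda>x. f2 x * of_real (euler_wave 0 x)) has_integral
      (f1 (real n + 1) * of_real (real n + 1 - (real n + 1)) + f (real n + 1)) -
      (f1 (real n) * of_real (real n + 1 - real n) + f (real n))) {real n..real n + 1}"
    using False by (intro has_integral_cong) (simp add: euler_wave_0_unit_interval[of n])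
  finally show ?thesis
    using False by (simp add: algebra_simps)
qed

text \<open>The term with \<open>f1\<close> survives only at an odd end point, because the triangle
  wave is 1 at odd and 0 at even integers.\<close>

lemma has_integral_euler_wave_0:
  fixes f f1 f2 :: "real \<Rightarrow> complex"
  assumes f: "\<And>x. x \<ge> 0 \<Longrightarrow> (f has_vector_derivative f1 x) (at x)"
    and f1: "\<And>x. x \<ge> 0 \<Longrightarrow> (f1 has_vector_derivative f2 x) (at x)"
  shows "((\<lambda>x. f2 x * of_real (euler_wave 0 x)) has_integral
           (2 * (\<Sum>k<n. (-1) ^ k * f (real k)) - f 0 + (-1) ^ n * f (real n) + (if odd n then f1 (real n) else 0)))
         {0..real n}"
proof (induction n)
  case 0
  then show ?case
    by (simp add: has_integral_refl)
next
  case (Suc n)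
  have "((\<lambda>x. f2 x * of_real (euler_wave 0 x)) has_integral
      (2 * (\<Sum>k<n. (-1) ^ k * f (real k)) - f 0 + (-1) ^ n * f (real n) + (if odd n then f1 (real n) else 0)) +
      (if even n then f1 (real n + 1) - f (real n + 1) + f (real n)
            else f (real n + 1) - f (real n) - f1 (real n))) {0..real n + 1}"
    by (rule has_integral_combine[OF _ _ Suc has_integral_euler_wave_unit_interval[OF f f1]]) auto
  then show ?case
    by (cases "even n") (simp_all add: algebra_simps)
qed

text \<open>Only the second derivative has to be absolutely integrable, while \<open>f\<close> and
  \<open>f1\<close> need only tend to 0. Hence the formula also reaches the conditionally convergent
  range 0 < Re s <= 1.\<close>

lemma alternating_sums_euler_wave:
  fixes f f1 f2 :: "real \<Rightarrow> complex"
  assumes f: "\<And>x. x \<ge> 0 \<Longrightarrow> (f has_vector_derivative f1 x) (at x)"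
    and f1: "\<And>x. x \<ge> 0 \<Longrightarrow> (f1 has_vector_derivative f2 x) (at x)"
    and lim: "(f \<longlongrightarrow> 0) at_top" "(f1 \<longlongrightarrow> 0) at_top"
    and f2: "f2 absolutely_integrable_on {0..}"
  shows "(\<lambda>k. (-1) ^ k * f (real k)) sums
           (1/2 * f 0 + 1/2 * integral {0..} (\<lambda>x. f2 x * of_real (euler_wave 0 x)))"
proof -
  define g where "g = (\<lambda>x. f2 x * of_real (euler_wave 0 x))"
  have g: "g absolutely_integrable_on {0..}"
    unfolding g_def by (rule absolutely_integrable_mult_euler_wave[OF f2])
  have gb: "g absolutely_integrable_on {0..b}" for b
    by (rule set_integrable_subset[OF g]) auto
  have "((\<lambda>b. set_lebesgue_integral lebesgue {0..b} g) \<longlongrightarrow> set_lebesgue_integral lebesgue {0..} g) at_top"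
    by (rule tendsto_set_lebesgue_integral_at_top) (use g in auto)
  then have "((\<lambda>b. integral {0..b} g) \<longlongrightarrow> integral {0..} g) at_top"
    by (simp add: set_lebesgue_integral_eq_integral(2)[OF gb] set_lebesgue_integral_eq_integral(2)[OF g])
  then have "(\<lambda>n. integral {0..real n} g) \<longlonglongrightarrow> integral {0..} g"
    by (rule filterlim_compose) (rule filterlim_real_sequentially)
  moreover have "integral {0..real n} g =
      2 * (\<Sum>k<n. (-1) ^ k * f (real k)) - f 0 + (-1) ^ n * f (real n) + (if odd n then f1 (real n) else 0)" for n
    unfolding g_def by (rule integral_unique[OF has_integral_euler_wave_0[OF f f1]])
  ultimately have 1: "(\<lambda>n. 2 * (\<Sum>k<n. (-1) ^ k * f (real k)) - f 0 + (-1) ^ n * f (real n) +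
      (if odd n then f1 (real n) else 0)) \<longlonglongrightarrow> integral {0..} g"
    by simp
  have lims: "(\<lambda>n. f (real n)) \<longlonglongrightarrow> 0" "(\<lambda>n. f1 (real n)) \<longlonglongrightarrow> 0"
    using lim by (auto intro: filterlim_compose filterlim_real_sequentially)
  have 2: "(\<lambda>n. (-1) ^ n * f (real n)) \<longlonglongrightarrow> 0"
    by (rule Lim_null_comparison[OF _ tendsto_norm_zero[OF lims(1)]]) (auto simp: norm_mult norm_power)
  have 3: "(\<lambda>n. if odd n then f1 (real n) else 0) \<longlonglongrightarrow> 0"
    by (rule Lim_null_comparison[OF _ tendsto_norm_zero[OF lims(2)]]) auto
  have "(\<lambda>n. 1/2 * ((2 * (\<Sum>k<n. (-1) ^ k * f (real k)) - f 0 + (-1) ^ n * f (real n) +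
      (if odd n then f1 (real n) else 0)) + f 0 - (-1) ^ n * f (real n) - (if odd n then f1 (real n) else 0)))
      \<longlonglongrightarrow> 1/2 * (integral {0..} g + f 0 - 0 - 0)"
    by (intro tendsto_intros 1 2 3)
  then show ?thesis
    by (simp add: sums_def g_def algebra_simps add_divide_distrib)
qed

text \<open>Two integrations by parts raise the order. With W the wave of order N + 1, the function
  \<open>g1\<close> W - \<open>g\<close> W' vanishes at 0 because W and W' do, and at infinity
  because they are bounded. The constant in W'' yields the term with
  \<open>euler_coeff N\<close>.\<close>

lemma integral_mult_euler_wave_Suc:
  fixes g g1 g2 :: "real \<Rightarrow> complex"
  assumes g: "\<And>x. x \<ge> 0 \<Longrightarrow> (g has_vector_derivative g1 x) (at x)"
    and g1: "\<And>x. x \<ge> 0 \<Longrightarrow> (g1 has_vector_derivative g2 x) (at x)"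
    and lim: "(g \<longlongrightarrow> 0) at_top" "(g1 \<longlongrightarrow> 0) at_top"
    and int: "g absolutely_integrable_on {0..}" "g2 absolutely_integrable_on {0..}"
  shows "integral {0..} (\<lambda>x. g x * of_real (euler_wave N x)) =
           of_real (euler_coeff N) * integral {0..} g -
           integral {0..} (\<lambda>x. g2 x * of_real (euler_wave (Suc N) x))"
proof -
  define H where "H = (\<lambda>x. g1 x * of_real (euler_wave (Suc N) x) - g x * of_real (euler_wave' (Suc N) x))"
  define h where "h = (\<lambda>x. g x * of_real (euler_wave N x) - of_real (euler_coeff N) * g x +
      g2 x * of_real (euler_wave (Suc N) x))"
  have int': "(\<lambda>x. g x * of_real (euler_wave N x)) absolutely_integrable_on {0..}"
    "(\<lambda>x. of_real (euler_coeff N) * g x) absolutely_integrable_on {0..}"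
    "(\<lambda>x. g2 x * of_real (euler_wave (Suc N) x)) absolutely_integrable_on {0..}"
    by (intro absolutely_integrable_mult_euler_wave set_integrable_mult_right int)+
  have "(h has_integral 0 - H 0) {0..}"
  proof (rule has_integral_FTC_atLeast)
    show "h absolutely_integrable_on {0..}"
      unfolding h_def by (intro set_integral_add set_integral_diff int')
    show "(H has_vector_derivative h x) (at x)" if "x \<ge> 0" for x
    proof -
      have w: "((\<lambda>x. complex_of_real (euler_wave (Suc N) x)) has_vector_derivative of_real (euler_wave' (Suc N) x)) (at x)"
        by (intro has_vector_derivative_of_real) (simp add: DERIV_euler_wave flip: has_real_derivative_iff_has_vector_derivative)
      have w': "((\<lambda>x. complex_of_real (euler_wave' (Suc N) x)) has_vector_derivative of_real (euler_coeff N - euler_wave N x)) (at x)"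
        by (intro has_vector_derivative_of_real) (simp add: DERIV_euler_wave' flip: has_real_derivative_iff_has_vector_derivative)
      have "(H has_vector_derivative
          (g1 x * of_real (euler_wave' (Suc N) x) + g2 x * of_real (euler_wave (Suc N) x)) -
          (g x * of_real (euler_coeff N - euler_wave N x) + g1 x * of_real (euler_wave' (Suc N) x))) (at x)"
        unfolding H_def by (intro has_vector_derivative_diff has_vector_derivative_mult g g1 that w w')
      then show ?thesis
        by (simp add: h_def algebra_simps)
    qed
    show "(H \<longlongrightarrow> 0) at_top"
    proof (rule Lim_null_comparison)
      define C where "C = (\<Sum>r. 4 / odd_pi r ^ (2 * Suc N + 1))"
      show "\<forall>\<^sub>F x in at_top. norm (H x) \<le> norm (g1 x) * (2 * euler_coeff (Suc N)) + norm (g x) * C"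
      proof (rule always_eventually, rule allI)
        fix x
        have "norm (H x) \<le> norm (g1 x) * \<bar>euler_wave (Suc N) x\<bar> + norm (g x) * \<bar>euler_wave' (Suc N) x\<bar>"
          unfolding H_def by (rule order_trans[OF norm_triangle_ineq4]) (simp add: norm_mult)
        also have "\<dots> \<le> norm (g1 x) * (2 * euler_coeff (Suc N)) + norm (g x) * C"
          using euler_wave_bounds[of "Suc N" x] abs_euler_wave'_le[of "Suc N" x]
          by (intro add_mono mult_left_mono) (auto simp: C_def)
        finally show "norm (H x) \<le> norm (g1 x) * (2 * euler_coeff (Suc N)) + norm (g x) * C" .
      qed
      show "((\<lambda>x. norm (g1 x) * (2 * euler_coeff (Suc N)) + norm (g x) * C) \<longlongrightarrow> 0) at_top"
        by (intro tendsto_add_zero tendsto_mult_left_zero tendsto_norm_zero lim)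
    qed
  qed
  then have "integral {0..} h = 0"
    by (simp add: integral_unique H_def)
  moreover have "integral {0..} h = integral {0..} (\<lambda>x. g x * of_real (euler_wave N x)) -
      of_real (euler_coeff N) * integral {0..} g + integral {0..} (\<lambda>x. g2 x * of_real (euler_wave (Suc N) x))"
    unfolding h_def
    by (intro integral_unique has_integral_add has_integral_diff has_integral_mult_right integrable_integral
          set_lebesgue_integral_eq_integral(1) int' int)
  ultimately show ?thesis
    by (simp add: algebra_simps)
qed

section \<open>Euler polynomials at zero\<close>

lemma euler_coeff_le: "0 \<le> euler_coeff k" "euler_coeff k \<le> euler_coeff 0"
proof -
  show "0 \<le> euler_coeff k"
    unfolding euler_coeff_def by (intro suminf_nonneg summable_odd_pi) (auto simp: less_imp_le)
  show "euler_coeff k \<le> euler_coeff 0"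
    unfolding euler_coeff_def
  proof (intro suminf_le summable_odd_pi)
    fix r
    have "odd_pi r ^ (2 * 0 + 2) \<le> odd_pi r ^ (2 * k + 2)"
      using odd_pi_ge[of r] by (intro power_increasing) auto
    then show "4 / odd_pi r ^ (2 * k + 2) \<le> 4 / odd_pi r ^ (2 * 0 + 2)"
      by (intro divide_left_mono) auto
  qed auto
qed

text \<open>The right side is tanh(t/2). It arises from the summation formula for exp(- t x): the
  alternating sum is a geometric series, and each raising of the order splits off one term of the
  power series.\<close>

lemma euler_coeff_sums:
  fixes t :: real
  assumes t: "0 < t" "t < 1"
  shows "(\<lambda>k. (-1) ^ k * euler_coeff k * t ^ (2 * k + 1)) sums (1 - 2 / (exp t + 1))"
proof -
  define e where "e = (\<lambda>x. exp (- complex_of_real t * of_real x))"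
  define J where "J = (\<lambda>N. integral {0..} (\<lambda>x. e x * of_real (euler_wave N x)))"
  have e_deriv: "(e has_vector_derivative - of_real t * e x) (at x)" for x
  proof -
    have "((\<lambda>z. exp (- complex_of_real t * z)) has_field_derivative - of_real t * e x) (at (of_real x))"
      by (auto intro!: derivative_eq_intros simp: e_def)
    then show ?thesis
      unfolding e_def by (rule has_vector_derivative_real_field)
  qed
  have e_deriv': "((\<lambda>x. c * e x) has_vector_derivative c * (- of_real t) * e x) (at x)" for c x
    using has_vector_derivative_mult_right[OF e_deriv, of c x] by (simp add: mult.assoc)
  have norm_e: "norm (e x) = exp (- t * x)" for x
    by (simp add: e_def)
  have "((\<lambda>x. exp (- t * x)) \<longlongrightarrow> 0) at_top"
    using t by real_asymp
  then have e_lim: "(e \<longlongrightarrow> 0) at_top"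
    by (subst tendsto_norm_zero_iff[symmetric]) (simp add: norm_e)
  have e_int: "e absolutely_integrable_on {0..}"
  proof (rule measurable_bounded_by_integrable_imp_absolutely_integrable)
    show "e \<in> borel_measurable (lebesgue_on {0..})"
      unfolding e_def by (intro continuous_imp_measurable_on_sets_lebesgue continuous_intros) auto
    show "(\<lambda>x. exp (- t * x)) integrable_on {0..}"
      using has_integral_exp_minus_to_infinity[OF t(1), of 0] by (auto simp: integrable_on_def)
  qed (auto simp: norm_e)
  have "(e has_integral 0 - (- 1 / of_real t) * e 0) {0..}"
  proof (rule has_integral_FTC_atLeast[OF e_int])
    show "((\<lambda>x. (- 1 / of_real t) * e x) has_vector_derivative e x) (at x)" for x
      using e_deriv'[of "- 1 / of_real t" x] t by simp
    show "((\<lambda>x. (- 1 / of_real t) * e x) \<longlongrightarrow> 0) at_top"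
      by (intro tendsto_mult_right_zero e_lim)
  qed
  then have e_integral: "integral {0..} e = 1 / of_real t"
    by (simp add: integral_unique e_def)
  \<comment> \<open>The second derivative of exp(- t x) reproduces it with factor t^2, so the
    order-raising step becomes a recurrence.\<close>
  have J_Suc: "J N = of_real (euler_coeff N) / of_real t - of_real t ^ 2 * J (Suc N)" for N
  proof -
    have "J N = of_real (euler_coeff N) * integral {0..} e -
        integral {0..} (\<lambda>x. (of_real t ^ 2 * e x) * of_real (euler_wave (Suc N) x))"
      unfolding J_def
    proof (rule integral_mult_euler_wave_Suc)
      show "((\<lambda>x. - of_real t * e x) has_vector_derivative of_real t ^ 2 * e x) (at x)" for x
        using e_deriv'[of "- of_real t" x] by (simp add: power2_eq_square)
      show "((\<lambda>x. - of_real t * e x) \<longlongrightarrow> 0) at_top"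
        by (intro tendsto_mult_right_zero e_lim)
    qed (intro e_deriv e_lim e_int set_integrable_mult_right)+
    then show ?thesis
      by (simp add: e_integral J_def mult.assoc)
  qed
  have J_bound: "norm (J N) \<le> 2 * euler_coeff 0 / t" for N
  proof -
    have "norm (J N) \<le> integral {0..} (\<lambda>x. 2 * euler_coeff 0 * exp (- t * x))"
      unfolding J_def
    proof (rule integral_norm_bound_integral)
      show "(\<lambda>x. e x * of_real (euler_wave N x)) integrable_on {0..}"
        by (intro set_lebesgue_integral_eq_integral(1) absolutely_integrable_mult_euler_wave e_int)
      show "(\<lambda>x. 2 * euler_coeff 0 * exp (- t * x)) integrable_on {0..}"
        using has_integral_exp_minus_to_infinity[OF t(1), of 0]
        by (intro integrable_on_mult_right) (auto simp: integrable_on_def)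
      fix x :: real
      have "\<bar>euler_wave N x\<bar> \<le> 2 * euler_coeff 0"
        using euler_wave_bounds[of N x] euler_coeff_le[of N] by linarith
      then show "norm (e x * of_real (euler_wave N x)) \<le> 2 * euler_coeff 0 * exp (- t * x)"
        by (simp add: norm_mult norm_e mult.commute)
    qed
    also have "\<dots> = 2 * euler_coeff 0 / t"
      using has_integral_exp_minus_to_infinity[OF t(1), of 0] by (simp add: integral_unique)
    finally show ?thesis .
  qed
  have J_sum: "of_real t ^ 2 * J 0 =
      (\<Sum>k<N. (-1) ^ k * of_real (euler_coeff k) * of_real t ^ (2 * k + 1)) + (-1) ^ N * of_real t ^ (2 * N + 2) * J N" for N
  proof (induction N)
    case (Suc N)
    have "of_real t ^ (2 * N + 2) * J N = of_real (euler_coeff N) * of_real t ^ (2 * N + 1) - of_real t ^ (2 * Suc N + 2) * J (Suc N)"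
      unfolding J_Suc[of N] using t by (simp add: field_simps power2_eq_square)
    then have "(-1) ^ N * of_real t ^ (2 * N + 2) * J N =
       (-1) ^ N * (of_real (euler_coeff N) * of_real t ^ (2 * N + 1) - of_real t ^ (2 * Suc N + 2) * J (Suc N))"
      by (simp only: mult.assoc)
    then show ?case
      unfolding Suc.IH by (simp add: algebra_simps)
  qed (simp add: power2_eq_square)
  have "(\<lambda>k. (-1) ^ k * e (real k)) sums
      (1/2 * e 0 + 1/2 * integral {0..} (\<lambda>x. (of_real t ^ 2 * e x) * of_real (euler_wave 0 x)))"
  proof (rule alternating_sums_euler_wave)
    show "((\<lambda>x. - of_real t * e x) has_vector_derivative of_real t ^ 2 * e x) (at x)" for x
      using e_deriv'[of "- of_real t" x] by (simp add: power2_eq_square)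
    show "((\<lambda>x. - of_real t * e x) \<longlongrightarrow> 0) at_top"
      by (intro tendsto_mult_right_zero e_lim)
  qed (intro e_deriv e_lim e_int set_integrable_mult_right)+
  moreover have "(-1) ^ k * e (real k) = (- exp (- of_real t)) ^ k" for k
    by (simp add: e_def power_minus[of "exp _"] mult.commute flip: exp_of_nat_mult)
  moreover have "(\<lambda>k. (- exp (- complex_of_real t)) ^ k) sums (1 / (1 - (- exp (- of_real t))))"
    using t by (intro geometric_sums) simp
  ultimately have "1/2 * e 0 + 1/2 * (of_real t ^ 2 * J 0) = 1 / (1 + exp (- of_real t))"
    by (simp add: sums_iff J_def mult.assoc)
  then have "of_real t ^ 2 * J 0 = 2 / (1 + exp (- of_real t)) - 1"
    by (simp add: e_def field_simps)
  also have "\<dots> = of_real (1 - 2 / (exp t + 1))"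
  proof -
    have "exp t + 1 > 0"
      by (intro add_pos_pos) auto
    then have "2 / (1 + exp (- t)) - 1 = 1 - 2 / (exp t + 1)"
      by (simp add: exp_minus field_simps)
    then show ?thesis
      by (metis (no_types, lifting) exp_of_real of_real_1 of_real_add of_real_diff of_real_divide of_real_minus of_real_numeral)
  qed
  finally have J0: "of_real t ^ 2 * J 0 = of_real (1 - 2 / (exp t + 1))" .
  \<comment> \<open>The bound on \<open>J N\<close> is uniform in \<open>N\<close>, so t < 1 alone
    forces the remainder to 0.\<close>
  have "(\<lambda>N. (-1) ^ N * of_real t ^ (2 * N + 2) * J N) \<longlonglongrightarrow> 0"
  proof (rule Lim_null_comparison)
    show "\<forall>\<^sub>F N in sequentially. norm ((-1) ^ N * of_real t ^ (2 * N + 2) * J N) \<le> t ^ (2 * N + 2) * (2 * euler_coeff 0 / t)"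
    proof (rule always_eventually, rule allI)
      fix N
      have "norm ((-1) ^ N * of_real t ^ (2 * N + 2) * J N) = t ^ (2 * N + 2) * norm (J N)"
        using t by (simp add: norm_mult norm_power)
      also have "\<dots> \<le> t ^ (2 * N + 2) * (2 * euler_coeff 0 / t)"
        using t J_bound by (intro mult_left_mono) auto
      finally show "norm ((-1) ^ N * of_real t ^ (2 * N + 2) * J N) \<le> t ^ (2 * N + 2) * (2 * euler_coeff 0 / t)" .
    qed
    have "(\<lambda>N. t ^ (2 * N + 2)) \<longlonglongrightarrow> 0"
      using t by (intro filterlim_compose[OF LIMSEQ_power_zero[of t]]) (simp, real_asymp)
    then show "(\<lambda>N. t ^ (2 * N + 2) * (2 * euler_coeff 0 / t)) \<longlonglongrightarrow> 0"
      by (rule tendsto_mult_left_zero)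
  qed
  then have "(\<lambda>N. of_real t ^ 2 * J 0 - (-1) ^ N * of_real t ^ (2 * N + 2) * J N) \<longlonglongrightarrow> of_real t ^ 2 * J 0 - 0"
    by (intro tendsto_diff tendsto_const)
  also have "(\<lambda>N. of_real t ^ 2 * J 0 - (-1) ^ N * of_real t ^ (2 * N + 2) * J N) =
      (\<lambda>N. \<Sum>k<N. of_real ((-1) ^ k * euler_coeff k * t ^ (2 * k + 1)))"
  proof
    show "of_real t ^ 2 * J 0 - (-1) ^ N * of_real t ^ (2 * N + 2) * J N =
        (\<Sum>k<N. of_real ((-1) ^ k * euler_coeff k * t ^ (2 * k + 1)))" for N
      unfolding J_sum[of N] by simp
  qed
  finally have "(\<lambda>k. complex_of_real ((-1) ^ k * euler_coeff k * t ^ (2 * k + 1))) sums of_real (1 - 2 / (exp t + 1))"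
    by (simp add: sums_def J0)
  then show ?thesis
    by (simp only: sums_of_real_iff)
qed

text \<open>Two power series describe 2/(e^t + 1) for small t > 0: the generating function at x = 0
  and 1 - tanh(t/2) with its coefficients given by the zeta-like sums. Their difference vanishes on
  (0,1), which accumulates at the centre, so the coefficients agree.\<close>

lemma euler_poly_odd_0:
  "euler_poly (2 * k + 1) 0 / fact (2 * k + 1) = - ((-1) ^ k * of_real (euler_coeff k))"
proof -
  \<comment> \<open>The coefficients of 1 - tanh(t/2): constant term 1 and otherwise only odd
    powers, since tanh is odd.\<close>
  define d where "d = (\<lambda>n. if n = 0 then 1 else if odd n then - ((-1) ^ (n div 2) * complex_of_real (euler_coeff (n div 2))) else 0)"
  define a where "a = (\<lambda>n. euler_poly n 0 / fact n - d n)"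
  have E: "(\<lambda>n. euler_poly n 0 / fact n * t ^ n) sums (2 / (exp t + 1))" if "norm t < 1" for t :: complex
    using euler_poly_sums[of t 0] that pi_gt3 by (simp add: mult_ac)
  have d_summable: "summable (\<lambda>n. d n * t ^ n)" if t: "norm t < 1" for t
  proof (rule summable_comparison_test')
    show "summable (\<lambda>n. (1 + euler_coeff 0) * norm t ^ n)"
      using t by (intro summable_mult summable_geometric) auto
    have "norm (d n) \<le> 1 + euler_coeff 0" for n
      using euler_coeff_le[of "n div 2"] by (auto simp: d_def norm_mult norm_power)
    then show "norm (d n * t ^ n) \<le> (1 + euler_coeff 0) * norm t ^ n" for n
      by (auto simp: norm_mult norm_power intro!: mult_right_mono)
  qed
  define f where "f = (\<lambda>t. 2 / (exp t + 1) - (\<Sum>n. d n * t ^ n))"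
  have f: "(\<lambda>n. a n * (t - 0) ^ n) sums f t" if "norm (t - 0) < 1" for t
    using sums_diff[OF E summable_sums[OF d_summable]] that by (simp add: a_def f_def algebra_simps)
  have f_real: "f (of_real t) = 0" if t: "0 < t" "t < 1" for t
  proof -
    have "(\<lambda>k. complex_of_real (- ((-1) ^ k * euler_coeff k * t ^ (2 * k + 1)))) sums of_real (- (1 - 2 / (exp t + 1)))"
      unfolding sums_of_real_iff by (intro sums_minus euler_coeff_sums t)
    also have "(\<lambda>k. complex_of_real (- ((-1) ^ k * euler_coeff k * t ^ (2 * k + 1)))) =
        (\<lambda>k. (\<lambda>n. if odd n then d n * of_real t ^ n else 0) (2 * k + 1))"
      by (auto simp: d_def fun_eq_iff)
    finally have "(\<lambda>n. if odd n then d n * of_real t ^ n else 0) sums of_real (- (1 - 2 / (exp t + 1)))"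
      by (subst (asm) sums_mono_reindex) (auto simp: strict_mono_def elim!: oddE)
    then have "(\<lambda>n. (if n = 0 then 1 else 0) + (if odd n then d n * of_real t ^ n else 0)) sums
        (1 + of_real (- (1 - 2 / (exp t + 1))))"
      using sums_single[of 0 "\<lambda>_. 1 :: complex"] by (intro sums_add) auto
    also have "(\<lambda>n. (if n = 0 then 1 else 0) + (if odd n then d n * of_real t ^ n else 0)) = (\<lambda>n. d n * of_real t ^ n)"
      by (auto simp: d_def fun_eq_iff)
    finally have "(\<Sum>n. d n * of_real t ^ n) = 1 + of_real (- (1 - 2 / (exp t + 1)))"
      by (rule sums_unique[symmetric])
    then show ?thesis
      by (simp add: f_def exp_of_real)
  qed
  have f0: "f 0 = 0"
    using powser_sums_zero[of d] by (simp add: f_def sums_iff d_def powser_sums_zero_iff)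
  have "a 0 = 0"
    using f[of 0] f0 powser_sums_zero[of a] by (simp add: sums_iff)
  have "a (2 * k + 1) = 0"
  proof (rule ccontr)
    assume "a (2 * k + 1) \<noteq> 0"
    \<comment> \<open>A nonzero coefficient would make \<open>f\<close> zero-free in a punctured
      disc, contradicting its zeros on the positive real axis.\<close>
    then obtain s where s: "s > 0" "\<And>z. z \<in> cball 0 s - {0} \<Longrightarrow> f z \<noteq> 0"
      using powser_0_nonzero[of 1 0 a f "2 * k + 1", OF _ f f0] by auto
    define u where "u = min s (1/2)"
    have "f (of_real u) \<noteq> 0"
      using s(1) by (intro s(2)) (auto simp: u_def)
    moreover have "f (of_real u) = 0"
      using s(1) by (intro f_real) (auto simp: u_def)
    ultimately show False
      by contradiction
  qed
  then show ?thesis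
    by (simp add: a_def d_def eq_neg_iff_add_eq_0)
qed

section \<open>The alternating Hurwitz zeta function\<close>

definition wave_integral :: "complex \<Rightarrow> nat \<Rightarrow> complex \<Rightarrow> complex" where
  "wave_integral q N s =
     integral {0..} (\<lambda>x::real. (q + of_real x) powr (- s - of_nat (2 * N + 2)) * of_real (euler_wave N x))"

text \<open>Boole's formula of order \<open>N\<close> for the function x to (q + x)^(-s). Its
  integral converges for Re s > - 2 N - 1, so increasing orders continue the series to larger
  half-planes.\<close>

definition boole_zeta :: "complex \<Rightarrow> nat \<Rightarrow> complex \<Rightarrow> complex" where
  "boole_zeta q N s =
     1/2 * q powr (- s) +
     1/2 * (\<Sum>k<N. (-1) ^ k * of_real (euler_coeff k) * pochhammer s (2 * k + 1) * q powr (- s - of_nat (2 * k + 1))) +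
     1/2 * ((-1) ^ N * pochhammer s (2 * N + 2) * wave_integral q N s)"

context
  fixes q :: complex
  assumes q: "q \<notin> \<real>\<^sub>\<le>\<^sub>0"
begin

lemma absolutely_integrable_shifted_powr_1:
  assumes "Re b < -1"
  shows "(\<lambda>x. (q + of_real x) powr b) absolutely_integrable_on {0..}"
  using absolutely_integrable_shifted_powr[OF q assms, of "\<lambda>_. 1" 1] by simp

lemma boole_zeta_0_sums:
  assumes s: "Re s > 0"
  shows "(\<lambda>n. (-1) ^ n / (of_nat n + q) powr s) sums boole_zeta q 0 s"
proof -
  have "(\<lambda>k. (-1) ^ k * (q + of_real (real k)) powr (- s)) sums
     (1/2 * (q + of_real 0) powr (- s) + 1/2 * integral {0..} (\<lambda>x. (s * (s + 1) * (q + of_real x) powr (- s - 2)) * of_real (euler_wave 0 x)))"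
  proof (rule alternating_sums_euler_wave)
    show "((\<lambda>x::real. (q + of_real x) powr (- s)) has_vector_derivative - s * (q + of_real x) powr (- s - 1)) (at x)"
      if "x \<ge> 0" for x
      by (rule has_vector_derivative_shifted_powr[OF q that])
    show "((\<lambda>x::real. - s * (q + of_real x) powr (- s - 1)) has_vector_derivative s * (s + 1) * (q + of_real x) powr (- s - 2)) (at x)"
      if "x \<ge> 0" for x
      using has_vector_derivative_mult_right[OF has_vector_derivative_shifted_powr[OF q that, of "- s - 1"], of "- s"]
      by (simp add: algebra_simps)
    show "((\<lambda>x::real. (q + of_real x) powr (- s)) \<longlongrightarrow> 0) at_top"
      using s by (intro tendsto_shifted_powr_0 q) auto
    show "((\<lambda>x::real. - s * (q + of_real x) powr (- s - 1)) \<longlongrightarrow> 0) at_top"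
      using s by (intro tendsto_mult_right_zero tendsto_shifted_powr_0 q) auto
    show "(\<lambda>x. s * (s + 1) * (q + of_real x) powr (- s - 2)) absolutely_integrable_on {0..}"
      using s by (intro set_integrable_mult_right absolutely_integrable_shifted_powr_1) auto
  qed
  moreover have "(-1) ^ k * (q + of_real (real k)) powr (- s) = (-1) ^ k / (of_nat k + q) powr s" for k
    by (simp add: powr_minus divide_inverse add.commute)
  ultimately show ?thesis
    by (simp add: boole_zeta_def wave_integral_def pochhammer_Suc mult.assoc numeral_2_eq_2)
qed

text \<open>The order-raising step for the power function: two derivatives bring the factors s + 2N
  + 2 and s + 2N + 3 that extend the Pochhammer symbol, and integrating the bare power divides by s
  + 2N + 1, which cancels its last factor.\<close>

lemma wave_integral_Suc:
  assumes s: "Re s > - 2 * real N - 1"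
  shows "pochhammer s (2 * N + 2) * wave_integral q N s =
           of_real (euler_coeff N) * pochhammer s (2 * N + 1) * q powr (- s - of_nat (2 * N + 1)) -
           pochhammer s (2 * Suc N + 2) * wave_integral q (Suc N) s"
proof -
  define b where "b = - s - of_nat (2 * N + 2)"
  have b: "Re b < -1"
    using s by (simp add: b_def)
  have "wave_integral q N s = of_real (euler_coeff N) * integral {0..} (\<lambda>x::real. (q + of_real x) powr b) -
      integral {0..} (\<lambda>x. (b * (b - 1) * (q + of_real x) powr (b - 2)) * of_real (euler_wave (Suc N) x))"
    unfolding wave_integral_def b_def[symmetric]
  proof (rule integral_mult_euler_wave_Suc)
    show "((\<lambda>x::real. (q + of_real x) powr b) has_vector_derivative b * (q + of_real x) powr (b - 1)) (at x)"
      if "x \<ge> 0" for x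
      by (rule has_vector_derivative_shifted_powr[OF q that])
    show "((\<lambda>x::real. b * (q + of_real x) powr (b - 1)) has_vector_derivative b * (b - 1) * (q + of_real x) powr (b - 2)) (at x)"
      if "x \<ge> 0" for x
      using has_vector_derivative_mult_right[OF has_vector_derivative_shifted_powr[OF q that, of "b - 1"], of b]
      by (simp add: algebra_simps)
    show "((\<lambda>x::real. (q + of_real x) powr b) \<longlongrightarrow> 0) at_top"
      using b by (intro tendsto_shifted_powr_0 q) auto
    show "((\<lambda>x::real. b * (q + of_real x) powr (b - 1)) \<longlongrightarrow> 0) at_top"
      using b by (intro tendsto_mult_right_zero tendsto_shifted_powr_0 q) auto
    show "(\<lambda>x. (q + of_real x) powr b) absolutely_integrable_on {0..}"
      using b by (rule absolutely_integrable_shifted_powr_1)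
    show "(\<lambda>x. b * (b - 1) * (q + of_real x) powr (b - 2)) absolutely_integrable_on {0..}"
      using b by (intro set_integrable_mult_right absolutely_integrable_shifted_powr_1) auto
  qed
  also have "integral {0..} (\<lambda>x::real. (q + of_real x) powr b) = - (q powr (b + 1) / (b + 1))"
    by (rule integral_unique[OF has_integral_complex_shifted_powr[OF q b]])
  also have "b + 1 = - s - of_nat (2 * N + 1)"
    by (simp add: b_def)
  also have "integral {0..} (\<lambda>x. (b * (b - 1) * (q + of_real x) powr (b - 2)) * of_real (euler_wave (Suc N) x)) =
      b * (b - 1) * wave_integral q (Suc N) s"
  proof -
    have "b - 2 = - s - of_nat (2 * Suc N + 2)"
      by (simp add: b_def)
    then show ?thesis
      unfolding wave_integral_def by (simp only: mult.assoc integral_mult_right)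
  qed
  finally have "wave_integral q N s = of_real (euler_coeff N) * (q powr (- s - of_nat (2 * N + 1)) / (s + of_nat (2 * N + 1))) -
      (s + of_nat (2 * N + 2)) * (s + of_nat (2 * N + 3)) * wave_integral q (Suc N) s"
    by (simp add: b_def algebra_simps minus_divide_right)
  \<comment> \<open>The half-plane condition makes the real part positive; the cancellation needs
    this.\<close>
  moreover have "s + of_nat (2 * N + 1) \<noteq> 0"
    using s by (auto simp: complex_eq_iff)
  moreover have "pochhammer s (2 * N + 2) = pochhammer s (2 * N + 1) * (s + of_nat (2 * N + 1))"
    using pochhammer_Suc[of s "2 * N + 1"] by simp
  moreover have "pochhammer s (2 * Suc N + 2) = pochhammer s (2 * N + 2) * ((s + of_nat (2 * N + 2)) * (s + of_nat (2 * N + 3)))"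
    using pochhammer_Suc[of s "2 * N + 2"] pochhammer_Suc[of s "2 * N + 3"]
    by (simp add: numeral_eq_Suc algebra_simps)
  ultimately show ?thesis
    by (simp add: right_diff_distrib mult_ac)
qed

lemma boole_zeta_Suc:
  assumes s: "Re s > - 2 * real N - 1"
  shows "boole_zeta q (Suc N) s = boole_zeta q N s"
proof -
  have "(-1) ^ N * pochhammer s (2 * N + 2) * wave_integral q N s =
      (-1) ^ N * (of_real (euler_coeff N) * pochhammer s (2 * N + 1) * q powr (- s - of_nat (2 * N + 1)) -
           pochhammer s (2 * Suc N + 2) * wave_integral q (Suc N) s)"
    using wave_integral_Suc[OF s] by (simp only: mult.assoc)
  then show ?thesis
    unfolding boole_zeta_def by (simp add: algebra_simps)
qed

lemma boole_zeta_eq: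
  assumes "Re s > - 2 * real N - 1" "N \<le> M"
  shows "boole_zeta q M s = boole_zeta q N s"
  using assms(2)
proof (induction rule: dec_induct)
  case (step n)
  have "Re s > - 2 * real n - 1"
    using assms(1) step.hyps by simp
  then show ?case
    using boole_zeta_Suc step.IH by simp
qed simp

section \<open>Holomorphy and analytic continuation in s\<close>

text \<open>Truncated integrals are entire by differentiation under the integral sign. They converge
  uniformly on small closed balls, because one integrable function of \<open>x\<close> dominates the
  integrand for all \<open>s\<close> in the ball.\<close>

lemma wave_integral_holomorphic: "wave_integral q N holomorphic_on {s. Re s > - 2 * real N - 1}"
proof (rule holomorphic_uniform_sequence)
  define k where "k = (\<lambda>s (x::real). (q + of_real x) powr (- s - of_nat (2 * N + 2)) * of_real (euler_wave N x))"
  define f where "f = (\<lambda>(n::nat) s. integral {0..real n} (k s))"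
  have q0: "norm q > 0"
    using q by auto
  show "open {s. Re s > - 2 * real N - 1}"
    by (rule open_halfspace_Re_gt)
  show "f n holomorphic_on {s. Re s > - 2 * real N - 1}" for n
  proof -
    have qx: "q + of_real x \<noteq> 0" "q + of_real x \<notin> \<real>\<^sub>\<le>\<^sub>0" if "x \<ge> 0" for x :: real
      using add_nonneg_not_nonpos_Reals[OF q that] by auto
    have "(\<lambda>s. integral (cbox 0 (real n)) (k s)) holomorphic_on UNIV"
    proof (rule leibniz_rule_holomorphic)
      show "((\<lambda>s. k s x) has_field_derivative - Ln (q + of_real x) * k s x) (at s within UNIV)"
        if "x \<in> cbox 0 (real n)" for s x
        unfolding k_def powr_def using that qx[of x] by (auto intro!: derivative_eq_intros)
      have "continuous_on (UNIV \<times> cbox 0 (real n))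
          (\<lambda>p. exp ((- fst p - of_nat (2 * N + 2)) * Ln (q + of_real (snd p))) * of_real (euler_wave N (snd p)))"
        by (intro continuous_intros continuous_on_compose2[OF continuous_on_euler_wave[of UNIV]])
           (use qx in \<open>auto simp del: complex_nonpos_Reals_iff\<close>)
      then have cont: "continuous_on (UNIV \<times> cbox 0 (real n)) (\<lambda>(s, x). k s x)"
        by (rule continuous_on_eq) (use qx in \<open>auto simp: k_def powr_def\<close>)
      have "continuous_on (UNIV \<times> cbox 0 (real n)) (\<lambda>p. Ln (q + of_real (snd p)))"
        by (intro continuous_intros) (use qx in \<open>auto simp del: complex_nonpos_Reals_iff\<close>)
      then show "continuous_on (UNIV \<times> cbox 0 (real n)) (\<lambda>(s, x). - Ln (q + of_real x) * k s x)"
        using cont unfolding case_prod_unfold by (intro continuous_on_mult continuous_on_minus)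
      show "k s integrable_on cbox 0 (real n)" for s
      proof (rule integrable_continuous)
        show "continuous_on (cbox 0 (real n)) (k s)"
          by (rule continuous_on_compose2[OF cont, of _ "\<lambda>x. (s, x)", simplified]) (auto intro!: continuous_intros)
      qed
    qed auto
    then show ?thesis
      unfolding f_def by (auto intro: holomorphic_on_subset)
  qed
  fix s0 assume s0: "s0 \<in> {s. Re s > - 2 * real N - 1}"
  \<comment> \<open>Half the distance from \<open>s0\<close> to the boundary line, so on the ball
    the exponent has real part at most - 1 - d.\<close>
  define d where "d = (Re s0 + 2 * real N + 1) / 2"
  have d: "d > 0"
    using s0 by (simp add: d_def)
  have Re_ge: "Re s + 2 * real N + 1 \<ge> d" if "s \<in> cball s0 d" for s
    using that abs_Re_le_cmod[of "s0 - s"] by (simp add: dist_norm d_def)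
  have sub: "cball s0 d \<subseteq> {s. Re s > - 2 * real N - 1}"
    using Re_ge d by fastforce
  define \<beta> where "\<beta> = - 1 - d"
  \<comment> \<open>Everything in the bound that depends on \<open>s\<close>; it is continuous and
    hence bounded on the compact ball.\<close>
  define h where "h = (\<lambda>s. norm q powr (Re (- s - of_nat (2 * N + 2)) - \<beta>) *
      (cos (Arg q / 2) powr Re (- s - of_nat (2 * N + 2)) * exp (pi * \<bar>Im (- s - of_nat (2 * N + 2))\<bar>)))"
  have "continuous_on (cball s0 d) h"
    unfolding h_def using q0 cos_half_Arg_pos[OF q] by (intro continuous_intros) auto
  then obtain K where K: "K \<ge> 0" "\<And>s. s \<in> cball s0 d \<Longrightarrow> norm (h s) \<le> K"
    using continuous_on_compact_bound[OF compact_cball] by blast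
  define g where "g = (\<lambda>x. (norm q + x) powr \<beta> * (K * (2 * euler_coeff N)))"
  have k_le: "norm (k s x) \<le> g x" if s: "s \<in> cball s0 d" and x: "x \<ge> 0" for s x
  proof -
    define b where "b = - s - of_nat (2 * N + 2)"
    have b: "Re b \<le> \<beta>"
      using Re_ge[OF s] by (simp add: b_def \<beta>_def)
    have "norm ((q + of_real x) powr b) \<le> (norm q + x) powr Re b * (cos (Arg q / 2) powr Re b * exp (pi * \<bar>Im b\<bar>))"
      using b d by (intro norm_shifted_powr_le q x) (auto simp: \<beta>_def)
    \<comment> \<open>The excess exponent Re b - \<open>\<beta>\<close> is nonpositive, so its base
      may be lowered to |q|; the remaining power of |q| + x no longer depends on
      \<open>s\<close>.\<close>
    also have "(norm q + x) powr Re b = (norm q + x) powr (Re b - \<beta>) * (norm q + x) powr \<beta>"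
      by (simp flip: powr_add)
    also have "(norm q + x) powr (Re b - \<beta>) * (norm q + x) powr \<beta> * (cos (Arg q / 2) powr Re b * exp (pi * \<bar>Im b\<bar>)) \<le>
        norm q powr (Re b - \<beta>) * (norm q + x) powr \<beta> * (cos (Arg q / 2) powr Re b * exp (pi * \<bar>Im b\<bar>))"
      using q0 b x by (intro mult_right_mono powr_mono2') auto
    also have "\<dots> = (norm q + x) powr \<beta> * h s"
      by (simp add: h_def b_def mult_ac)
    also have "\<dots> \<le> (norm q + x) powr \<beta> * K"
      using K(2)[OF s] by (intro mult_left_mono) auto
    finally have 1: "norm ((q + of_real x) powr b) \<le> (norm q + x) powr \<beta> * K" .
    have "norm (k s x) = norm ((q + of_real x) powr b) * euler_wave N x"
      using euler_wave_bounds[of N x] by (simp add: k_def b_def norm_mult)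
    also have "\<dots> \<le> ((norm q + x) powr \<beta> * K) * (2 * euler_coeff N)"
      using 1 K euler_wave_bounds[of N x] by (intro mult_mono) auto
    finally show ?thesis
      by (simp add: g_def mult_ac)
  qed
  have k_int: "k s absolutely_integrable_on {0..}" if "s \<in> cball s0 d" for s
    unfolding k_def using Re_ge[OF that] d
    by (intro absolutely_integrable_mult_euler_wave absolutely_integrable_shifted_powr_1) simp
  have k_intb: "k s absolutely_integrable_on {0..b}" if "s \<in> cball s0 d" for s b
    by (rule set_integrable_subset[OF k_int[OF that]]) auto
  have g_int: "g absolutely_integrable_on {0..}"
    unfolding g_def using q0 d
    by (intro absolutely_integrable_shifted_powr_real[where B = "K * (2 * euler_coeff N)"])
       (use K euler_coeff_le in \<open>auto simp: \<beta>_def abs_mult\<close>)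
  have "uniform_limit (cball s0 d) (\<lambda>b s. set_lebesgue_integral lebesgue {0..b} (k s))
      (\<lambda>s. set_lebesgue_integral lebesgue {0..} (k s)) at_top"
  proof (rule uniform_limit_set_lebesgue_integral_at_top)
    show "set_borel_measurable lebesgue {0..} (k s)" if "s \<in> cball s0 d" for s
      using k_int[OF that] unfolding set_integrable_def set_borel_measurable_def
      by (rule borel_measurable_integrable)
  qed (use k_le g_int in auto)
  then have "uniform_limit (cball s0 d) (\<lambda>n s. set_lebesgue_integral lebesgue {0..real n} (k s))
      (\<lambda>s. set_lebesgue_integral lebesgue {0..} (k s)) sequentially"
    by (rule filterlim_compose) (rule filterlim_real_sequentially)
  also have "?this \<longleftrightarrow> uniform_limit (cball s0 d) f (wave_integral q N) sequentially"
  proof (rule uniform_limit_cong')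
    show "set_lebesgue_integral lebesgue {0..real n} (k s) = f n s" if "s \<in> cball s0 d" for n s
      by (simp add: f_def set_lebesgue_integral_eq_integral(2)[OF k_intb[OF that]])
    show "set_lebesgue_integral lebesgue {0..} (k s) = wave_integral q N s" if "s \<in> cball s0 d" for s
      unfolding set_lebesgue_integral_eq_integral(2)[OF k_int[OF that]] by (simp add: wave_integral_def k_def)
  qed
  finally show "\<exists>d>0. cball s0 d \<subseteq> {s. Re s > - 2 * real N - 1} \<and> uniform_limit (cball s0 d) f (wave_integral q N) sequentially"
    using d sub by blast
qed

lemma boole_zeta_holomorphic: "boole_zeta q N holomorphic_on {s. Re s > - 2 * real N - 1}"
proof -
  have q0: "q \<noteq> 0"
    using q by auto
  have 1: "(\<lambda>s. pochhammer s n) holomorphic_on A" for n A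
    unfolding pochhammer_prod by (intro holomorphic_intros)
  have 2: "(\<lambda>s. q powr (- s)) holomorphic_on A" "(\<lambda>s. q powr (- s - c)) holomorphic_on A" for c A
    unfolding powr_def using q0 by (auto intro!: holomorphic_intros)
  show ?thesis
    unfolding boole_zeta_def[abs_def]
    by (intro holomorphic_on_add holomorphic_on_mult holomorphic_on_sum holomorphic_on_const
          1 2 wave_integral_holomorphic)
qed

text \<open>Formulas of different orders agree where both integrals converge, so they glue to an
  entire function. It sums the series for Re s > 0, and the identity theorem on that half-plane
  makes it the function selected by the definite description.\<close>

lemma alt_hurwitz_zeta_eq_boole_zeta:
  assumes s: "Re s > - 2 * real N - 1"
  shows "alt_hurwitz_zeta s q = boole_zeta q N s"
proof -
  \<comment> \<open>The order is chosen from \<open>s\<close> itself, large enough that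
    \<open>s\<close> lies in the half-plane of that order.\<close>
  define Z where "Z = (\<lambda>s. boole_zeta q (nat \<lceil>\<bar>Re s\<bar>\<rceil>) s)"
  have Z_eq: "Z s = boole_zeta q N s" if "Re s > - 2 * real N - 1" for s N
  proof -
    have "Re s > - 2 * real (nat \<lceil>\<bar>Re s\<bar>\<rceil>) - 1"
      by linarith
    then show ?thesis
      unfolding Z_def using that boole_zeta_eq[of _ s "max N (nat \<lceil>\<bar>Re s\<bar>\<rceil>)"]
      by (metis max.cobounded1 max.cobounded2)
  qed
  have Z_holo: "Z holomorphic_on UNIV"
    unfolding holomorphic_on_def
  proof
    fix s :: complex
    define n where "n = nat \<lceil>\<bar>Re s\<bar>\<rceil>"
    define S where "S = {s. Re s > - 2 * real n - 1}"
    have "s \<in> S" "open S"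
      unfolding S_def n_def by (auto simp: open_halfspace_Re_gt) linarith
    moreover have "Z holomorphic_on S"
      using boole_zeta_holomorphic[of n] Z_eq by (subst holomorphic_cong[OF refl, of _ _ "boole_zeta q n"]) (auto simp: S_def)
    ultimately show "Z field_differentiable at s within UNIV"
      by (simp add: holomorphic_on_imp_differentiable_at)
  qed
  have Z_sums: "(\<lambda>n. (-1) ^ n / (of_nat n + q) powr z) sums Z z" if "Re z > 0" for z
    using boole_zeta_0_sums[OF that] Z_eq[of 0 z] that by simp
  have "(THE f. f holomorphic_on UNIV \<and> (\<forall>z. Re z > 0 \<longrightarrow> (\<lambda>n. (-1) ^ n / (of_nat n + q) powr z) sums f z)) = Z"
  proof (rule the_equality)
    show "Z holomorphic_on UNIV \<and> (\<forall>z. Re z > 0 \<longrightarrow> (\<lambda>n. (-1) ^ n / (of_nat n + q) powr z) sums Z z)"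
      using Z_holo Z_sums by blast
  next
    fix f assume f: "f holomorphic_on UNIV \<and> (\<forall>z. Re z > 0 \<longrightarrow> (\<lambda>n. (-1) ^ n / (of_nat n + q) powr z) sums f z)"
    have "f z = Z z" for z
    proof (rule analytic_continuation_open[of "{z. Re z > 0}" UNIV f Z])
      show "{z. Re z > 0} \<noteq> {}"
        by (auto intro!: exI[of _ 1])
      show "f z = Z z" if "z \<in> {z. Re z > 0}" for z
        using f Z_sums that sums_unique2 by blast
    qed (use f Z_holo in \<open>auto simp: open_halfspace_Re_gt\<close>)
    then show "f = Z"
      by blast
  qed
  then show ?thesis
    using Z_eq[OF s] by (simp add: alt_hurwitz_zeta_def)
qed

section \<open>The remainder as a series of terminants, and its bounds\<close>

text \<open>The finite sums in the two expansions cancel: E_{2k+1}(0)/(2k+1)! carries the opposite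
  sign of the Boole coefficient, which matches the minus sign before the bracket defining the
  remainder. Multiplying by q^s isolates the integral.\<close>

lemma alt_hurwitz_remainder_eq_wave_integral:
  assumes s: "Re s > - 2 * real N - 1"
  shows "alt_hurwitz_remainder N s q =
           - ((-1) ^ N * pochhammer s (2 * N + 2) * q powr s * wave_integral q N s)"
proof -
  have q0: "q \<noteq> 0"
    using q by auto
  define A where "A = (\<Sum>k<N. (-1) ^ k * of_real (euler_coeff k) * (pochhammer s (2 * k + 1) / q ^ (2 * k + 1)))"
  define W where "W = (-1) ^ N * pochhammer s (2 * N + 2) * wave_integral q N s"
  define R where "R = alt_hurwitz_remainder N s q"
  have "(\<Sum>k<N. euler_poly (2*k+1) 0 / fact (2*k+1) * (pochhammer s (2*k+1) / q ^ (2*k+1))) = - A"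
    unfolding A_def euler_poly_odd_0 by (simp add: sum_negf)
  then have 1: "alt_hurwitz_zeta s q = 1/2 * q powr (- s) - 1/2 * q powr (- s) * (- A + R)"
    using alt_hurwitz_remainder_eq[OF q0, of s N] by (simp add: R_def)
  have "(\<Sum>k<N. (-1) ^ k * of_real (euler_coeff k) * pochhammer s (2 * k + 1) * q powr (- s - of_nat (2 * k + 1))) = q powr (- s) * A"
    unfolding A_def sum_distrib_left powr_diff powr_complexpow[OF q0]
    by (intro sum.cong refl) (simp add: mult_ac)
  then have 2: "alt_hurwitz_zeta s q = 1/2 * q powr (- s) + 1/2 * (q powr (- s) * A) + 1/2 * W"
    unfolding alt_hurwitz_zeta_eq_boole_zeta[OF s] boole_zeta_def W_def by simp
  have "2 * alt_hurwitz_zeta s q = q powr (- s) - q powr (- s) * (- A + R)"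
    unfolding 1 by (simp add: right_diff_distrib)
  moreover have "2 * alt_hurwitz_zeta s q = q powr (- s) + q powr (- s) * A + W"
    unfolding 2 by (simp add: distrib_left)
  ultimately have "q powr (- s) * R = - W"
    by algebra
  then have "q powr s * (q powr (- s) * R) = - (q powr s * W)"
    by simp
  moreover have "q powr s * q powr (- s) = 1"
    using q0 by (simp add: powr_minus)
  ultimately show ?thesis
    by (simp add: R_def W_def mult.assoc[symmetric] mult.commute[of "q powr s"])
qed

text \<open>The cosine series of the wave is integrated term by term. Its terms are nonnegative, so
  the partial sums stay below 2 \<open>euler_coeff N\<close> and dominated convergence applies; each
  term is then a terminant divided by p q^p.\<close>

lemma wave_integral_sums_terminant:
  assumes s: "Re s > - 2 * real N - 1"
  shows "(\<lambda>r. of_real (4 / odd_pi r ^ (2 * N + 2)) * terminant (s + 2 * of_nat N + 1) (of_real (odd_pi r) * q)) sums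
           ((s + 2 * of_nat N + 1) * q powr (s + 2 * of_nat N + 1) * wave_integral q N s)"
proof -
  define p where "p = s + 2 * of_nat N + 1"
  have p: "Re p > 0"
    using s by (simp add: p_def)
  have exponent: "- s - of_nat (2 * N + 2) = - p - 1"
    by (simp add: p_def)
  define I where "I = (\<lambda>r. integral {0..} (\<lambda>x::real. (q + of_real x) powr (- p - 1) * of_real (1 - cos (odd_pi r * x))))"
  define t where "t = (\<lambda>r x. 4 * (1 - cos (odd_pi r * x)) / odd_pi r ^ (2 * N + 2))"
  have I: "(\<lambda>x::real. (q + of_real x) powr (- p - 1) * of_real (1 - cos (odd_pi r * x))) integrable_on {0..}" for r
    by (intro set_lebesgue_integral_eq_integral(1) absolutely_integrable_shifted_powr[OF q, where B = 2])
       (use p abs_one_minus_cos_le in \<open>auto intro!: continuous_intros simp del: of_real_diff\<close>)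
  have partial: "((\<lambda>x::real. (q + of_real x) powr (- p - 1) * of_real (\<Sum>r<n. t r x)) has_integral
      (\<Sum>r<n. of_real (4 / odd_pi r ^ (2 * N + 2)) * I r)) {0..}" for n
  proof -
    have "((\<lambda>x::real. \<Sum>r<n. of_real (4 / odd_pi r ^ (2 * N + 2)) * ((q + of_real x) powr (- p - 1) * of_real (1 - cos (odd_pi r * x))))
      has_integral (\<Sum>r<n. of_real (4 / odd_pi r ^ (2 * N + 2)) * I r)) {0..}"
      unfolding I_def by (intro has_integral_sum has_integral_mult_right integrable_integral I) auto
    moreover have "(\<Sum>r<n. of_real (4 / odd_pi r ^ (2 * N + 2)) * ((q + of_real x) powr (- p - 1) * of_real (1 - cos (odd_pi r * x)))) =
        (q + of_real x) powr (- p - 1) * of_real (\<Sum>r<n. t r x)" for x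
      unfolding of_real_sum sum_distrib_left by (intro sum.cong refl) (simp add: t_def)
    ultimately show ?thesis
      by simp
  qed
  have powr_int: "(\<lambda>x::real. (q + of_real x) powr (- p - 1)) absolutely_integrable_on {0..}"
    using p by (intro absolutely_integrable_shifted_powr_1) auto
  have "(\<lambda>n. integral {0..} (\<lambda>x::real. (q + of_real x) powr (- p - 1) * of_real (\<Sum>r<n. t r x))) \<longlonglongrightarrow>
      integral {0..} (\<lambda>x::real. (q + of_real x) powr (- p - 1) * of_real (euler_wave N x))"
  proof (rule dominated_convergence(2))
    show "(\<lambda>x::real. norm ((q + of_real x) powr (- p - 1)) * (2 * euler_coeff N)) integrable_on {0..}"
      using powr_int by (intro integrable_on_mult_left) (simp add: absolutely_integrable_on_def)
    show "(\<lambda>x::real. (q + of_real x) powr (- p - 1) * of_real (\<Sum>r<n. t r x)) integrable_on {0..}" for n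
      using partial by (auto simp: integrable_on_def)
    fix x :: real
    have nonneg: "t r x \<ge> 0" for r
      by (simp add: t_def less_imp_le)
    have "summable (\<lambda>r. t r x)" "(\<Sum>r. t r x) = euler_wave N x"
      unfolding t_def by (rule summable_euler_wave) (simp add: euler_wave_def)
    then have t_sums: "(\<lambda>r. t r x) sums euler_wave N x"
      by (simp add: sums_iff)
    have "(\<Sum>r<n. t r x) \<le> euler_wave N x" for n
      using sum_le_suminf[of "\<lambda>r. t r x" "{..<n}"] t_sums nonneg by (simp add: sums_iff)
    then have "norm (complex_of_real (\<Sum>r<n. t r x)) \<le> 2 * euler_coeff N" for n
      using sum_nonneg[of "{..<n}" "\<lambda>r. t r x"] nonneg euler_wave_bounds(2)[of N x]
      unfolding norm_of_real by (smt (verit, best))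
    then show "norm ((q + of_real x) powr (- p - 1) * of_real (\<Sum>r<n. t r x)) \<le>
        norm ((q + of_real x) powr (- p - 1)) * (2 * euler_coeff N)" for n
      unfolding norm_mult by (intro mult_left_mono) auto
    show "(\<lambda>n. (q + of_real x) powr (- p - 1) * of_real (\<Sum>r<n. t r x)) \<longlonglongrightarrow> (q + of_real x) powr (- p - 1) * of_real (euler_wave N x)"
      using t_sums unfolding sums_def by (intro tendsto_intros)
  qed
  then have "(\<lambda>r. of_real (4 / odd_pi r ^ (2 * N + 2)) * I r) sums wave_integral q N s"
    unfolding integral_unique[OF partial] wave_integral_def exponent sums_def .
  from sums_mult[OF this, of "p * q powr p"]
  have "(\<lambda>r. p * q powr p * (of_real (4 / odd_pi r ^ (2 * N + 2)) * I r)) sums (p * q powr p * wave_integral q N s)" .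
  moreover have "terminant p (of_real (odd_pi r) * q) = p * q powr p * I r" for r
    unfolding I_def by (rule terminant_eq_integral[OF p q]) simp
  ultimately show ?thesis
    unfolding p_def[symmetric] by (simp add: mult_ac)
qed

text \<open>The positive weights of the terminants sum to the absolute value of E_{2N+1}(0)/(2N+1)!,
  so any common bound \<open>B\<close> transfers to the remainder without loss. Both claims of the
  theorem are instances, one with the supremum and one with the explicit bound.\<close>

lemma norm_alt_hurwitz_remainder_le:
  assumes s: "Re s > - 2 * real N - 1"
    and B: "\<And>r. norm (terminant (s + 2 * of_nat N + 1) (of_real (odd_pi r) * q)) \<le> B"
  shows "norm (alt_hurwitz_remainder N s q) \<le>
           norm (euler_poly (2*N+1) 0) / fact (2*N+1) * (norm (pochhammer s (2*N+1)) / norm q ^ (2*N+1)) * B"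
proof -
  define p where "p = s + 2 * of_nat N + 1"
  define a where "a = (\<lambda>r. of_real (4 / odd_pi r ^ (2 * N + 2)) * terminant p (of_real (odd_pi r) * q))"
  have q0: "q \<noteq> 0"
    using q by auto
  have a_sums: "a sums (p * q powr p * wave_integral q N s)"
    unfolding a_def p_def by (rule wave_integral_sums_terminant[OF s])
  have a_le: "norm (a r) \<le> 4 / odd_pi r ^ (2 * N + 2) * B" for r
    unfolding a_def norm_mult norm_of_real using B[of r]
    by (intro mult_mono) (auto simp: p_def less_imp_le)
  have sB: "summable (\<lambda>r. 4 / odd_pi r ^ (2 * N + 2) * B)"
    by (intro summable_mult2 summable_odd_pi) auto
  have sa: "summable (\<lambda>r. norm (a r))"
    by (rule summable_comparison_test'[OF sB]) (use a_le in simp)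
  have "norm (p * q powr p * wave_integral q N s) = norm (\<Sum>r. a r)"
    using a_sums by (simp add: sums_iff)
  also have "\<dots> \<le> (\<Sum>r. norm (a r))"
    by (rule summable_norm[OF sa])
  also have "\<dots> \<le> (\<Sum>r. 4 / odd_pi r ^ (2 * N + 2) * B)"
    by (rule suminf_le[OF a_le sa sB])
  also have "\<dots> = euler_coeff N * B"
    unfolding euler_coeff_def by (intro suminf_mult2[symmetric] summable_odd_pi) auto
  also have "euler_coeff N = norm (euler_poly (2*N+1) 0) / fact (2*N+1)"
  proof -
    have "norm (euler_poly (2*N+1) 0 / fact (2*N+1)) = euler_coeff N"
      unfolding euler_poly_odd_0 using euler_coeff_le(1)[of N] by (simp add: norm_mult norm_power)
    then show ?thesis
      by (simp only: norm_divide norm_fact)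
  qed
  finally have le: "norm (p * q powr p * wave_integral q N s) \<le> norm (euler_poly (2*N+1) 0) / fact (2*N+1) * B" .
  \<comment> \<open>The last factor of the Pochhammer symbol is p, and q^p splits as q^s times an
    integer power; together they form the prefactor of the series of terminants.\<close>
  have "pochhammer s (2 * N + 2) = pochhammer s (2 * N + 1) * p"
    using pochhammer_Suc[of s "2 * N + 1"] by (simp add: p_def algebra_simps)
  moreover have "q powr p = q powr s * q ^ (2 * N + 1)"
  proof -
    have "p = s + of_nat (2 * N + 1)"
      by (simp add: p_def)
    then show ?thesis
      using q0 by (simp only: powr_add powr_nat) simp
  qed
  ultimately have "alt_hurwitz_remainder N s q =
      - ((-1) ^ N) * (pochhammer s (2 * N + 1) / q ^ (2 * N + 1)) * (p * q powr p * wave_integral q N s)"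
    unfolding alt_hurwitz_remainder_eq_wave_integral[OF s] using q0 by (simp add: field_simps)
  then have "norm (alt_hurwitz_remainder N s q) =
      norm (pochhammer s (2 * N + 1)) / norm q ^ (2 * N + 1) * norm (p * q powr p * wave_integral q N s)"
    by (simp only: norm_mult norm_minus_cancel norm_power norm_one power_one norm_divide mult_1_left)
  also have "\<dots> \<le> norm (pochhammer s (2 * N + 1)) / norm q ^ (2 * N + 1) * (norm (euler_poly (2*N+1) 0) / fact (2*N+1) * B)"
    by (intro mult_left_mono le) auto
  finally show ?thesis
    by (simp only: mult_ac)
qed

end

theorem theorem3p7:
  fixes N :: nat and s q :: complex
  assumes "N \<ge> 1"
    and "Re s > - 2 * real N - 1"
    and "q \<noteq> 0" and "\<bar>Arg q\<bar> < pi"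
  shows "norm (alt_hurwitz_remainder N s q) \<le>
           norm (euler_poly (2*N+1) 0) / fact (2*N+1) *
           (norm (pochhammer s (2*N+1)) / norm q ^ (2*N+1)) *
           (SUP r::nat. norm (terminant (s + 2 * of_nat N + 1) ((2 * of_nat r + 1) * of_real pi * q)))
         \<and>
         norm (alt_hurwitz_remainder N s q) \<le>
           norm (euler_poly (2*N+1) 0) / fact (2*N+1) *
           (norm (pochhammer s (2*N+1)) / norm q ^ (2*N+1)) *
           (norm (s + 2 * of_nat N + 1) / (Re s + 2 * real N + 1)) *
           (1 / cos (Arg q / 2)) powr (Re s + 2 * real N + 2) *
           max 1 (exp (- Im s * Arg q))"
proof -
  have q: "q \<notin> \<real>\<^sub>\<le>\<^sub>0"
    using assms(3,4) abs_Arg_less_pi_iff by blast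
  define B where "B = norm (s + 2 * of_nat N + 1) / (Re s + 2 * real N + 1) *
      (1 / cos (Arg q / 2)) powr (Re s + 2 * real N + 2) * max 1 (exp (- Im s * Arg q))"
  define T where "T = (\<lambda>r. norm (terminant (s + 2 * of_nat N + 1) (of_real (odd_pi r) * q)))"
  have T: "norm (terminant (s + 2 * of_nat N + 1) ((2 * of_nat r + 1) * of_real pi * q)) = T r" for r
    by (simp add: T_def odd_pi_def)
  have "Re (s + 2 * of_nat N + 1) > 0"
    using assms(2) by simp
  from norm_terminant_le[OF this q odd_pi_pos] have T_le: "T r \<le> B" for r
    by (simp add: T_def B_def add_ac)
  \<comment> \<open>The explicit bound also shows that the supremum is taken over a bounded set, so
    it really is an upper bound for each value.\<close>
  then have "bdd_above (range T)"
    by (intro bdd_aboveI[of _ B]) auto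
  then have "T r \<le> (SUP r. T r)" for r
    by (intro cSUP_upper) auto
  then have "norm (alt_hurwitz_remainder N s q) \<le>
      norm (euler_poly (2*N+1) 0) / fact (2*N+1) * (norm (pochhammer s (2*N+1)) / norm q ^ (2*N+1)) * (SUP r. T r)"
    by (intro norm_alt_hurwitz_remainder_le[OF q assms(2)]) (simp add: T_def)
  moreover have "norm (alt_hurwitz_remainder N s q) \<le>
      norm (euler_poly (2*N+1) 0) / fact (2*N+1) * (norm (pochhammer s (2*N+1)) / norm q ^ (2*N+1)) * B"
    using T_le by (intro norm_alt_hurwitz_remainder_le[OF q assms(2)]) (simp add: T_def)
  ultimately show ?thesis
    unfolding T by (simp add: B_def mult.assoc)
qed

end
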